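(* Let $\rightsquigarrow$ be an 8-eternal relation, $G$ a finite group, $p$ a prime divisor of $|G|$, and $S$ a Sylow $p$-subgroup of $G$. Suppose that there exists a subgroup $D$ of $S$ with $1<|D|<|S|$ such that every subgroup of $S$ of order $|D|$ or $p|D|$ is abelian, every subgroup $H$ of $S$ of order $|D|$ satisfies $H\rightsquigarrow G$, and, if $S$ is non-abelian, $p=2$ and $|S:D|>2$, every subgroup $H$ of $S$ of order $2|D|$ satisfies $H\rightsquigarrow G$. Then $\mathcal{F}_S(G)$ is supersolvable.
   Context: All groups are finite. $Z_{\mathfrak{U}}(G)$ denotes the supersolvable hypercenter of $G$: the largest normal subgroup $N$ of $G$ such that every chief factor of $G$ below $N$ is cyclic (of prime order). Let $\rightsquigarrow$ be a relation, defined for every finite group $G$, between subgroups $H\le G$ and $G$ (written $H\rightsquigarrow G$). It is called 8-eternal if for every finite group $G$ the following hold: (0) for all subgroups $H\le K\le G$, if $H\rightsquigarrow G$ then $H\rightsquigarrow K$; (8) for every prime divisor $p$ of $|G|$: if there exists a subgroup $D$ of $O_p(G)$ with $1<|D|<|O_p(G)|$ such that every subgroup $H$ of $O_p(G)$ of order $|D|$ satisfies $H\rightsquigarrow G$ and, in case $O_p(G)$ is a non-abelian $2$-group and $|O_p(G):D|>2$, every cyclic subgroup $H$ of $O_p(G)$ of order $2|D|$ satisfies $H\rightsquigarrow G$, then $O_p(G)\le Z_{\mathfrak{U}}(G)$. $\mathcal{F}_S(G)$ is the (saturated) fusion system on $S\in\mathrm{Syl}_p(G)$ whose objects are the subgroups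 of $S$ and whose morphisms $P\to Q$ are the maps $x\mapsto x^g$ with $g\in G$, $P^g\le Q$. A saturated fusion system $\mathcal{F}$ on a $p$-group $S$ is supersolvable if there is a series $1=S_0\le S_1\le\cdots\le S_n=S$ of strongly $\mathcal{F}$-closed subgroups of $S$ with $S_{i+1}/S_i$ cyclic for $0\le i\le n-1$. (A subgroup $T\le S$ is strongly $\mathcal{F}$-closed if for every $P\le T$ and every $\phi\in\mathrm{Hom}_{\mathcal{F}}(P,S)$ one has $P^{\phi}\le T$.) *)

theory Defs
  imports "HOL-Algebra.Elementary_Groups" "HOL-Computational_Algebra.Primes"
begin

definition is_p_subgroup :: "nat \<Rightarrow> ('a, 'b) monoid_scheme \<Rightarrow> 'a set \<Rightarrow> bool" where
  "is_p_subgroup p G P \<longleftrightarrow> subgroup P G \<and> (\<exists>n. card P = p ^ n)"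

definition sylow_subgroup :: "nat \<Rightarrow> ('a, 'b) monoid_scheme \<Rightarrow> 'a set \<Rightarrow> bool" where
  "sylow_subgroup p G S \<longleftrightarrow> subgroup S G \<and> card S = p ^ multiplicity p (order G)"

(* O_p(G). In a finite group a product of two normal p-subgroups is again one, so the greatest
   element (with respect to inclusion) exists. *)
definition p_core :: "nat \<Rightarrow> ('a, 'b) monoid_scheme \<Rightarrow> 'a set" where
  "p_core p G = (GREATEST N. N \<lhd> G \<and> is_p_subgroup p G N)"

definition chief_factor :: "('a, 'b) monoid_scheme \<Rightarrow> 'a set \<Rightarrow> 'a set \<Rightarrow> bool" where
  "chief_factor G H K \<longleftrightarrow> H \<lhd> G \<and> K \<lhd> G \<and> K \<subset> H \<and>
     (\<forall>L. L \<lhd> G \<longrightarrow> K \<subseteq> L \<longrightarrow> L \<subseteq> H \<longrightarrow> L = K \<or> L = H)"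

(* Z_U(G). The order of a cyclic chief factor of a finite group is automatically prime. As for the
   p-core, the product of two normal subgroups with the stated property has it again. *)
definition supersolvable_hypercenter :: "('a, 'b) monoid_scheme \<Rightarrow> 'a set" where
  "supersolvable_hypercenter G =
     (GREATEST N. N \<lhd> G \<and>
        (\<forall>H K. chief_factor G H K \<and> H \<subseteq> N \<longrightarrow> cyclic_group (G\<lparr>carrier := H\<rparr> Mod K)))"

(* rel H G is only ever evaluated for H a subgroup of a finite group G; its values elsewhere are
   irrelevant. Subgroups K of G enter as groups through G(carrier := K). *)
definition eternal8 :: "('a set \<Rightarrow> 'a monoid \<Rightarrow> bool) \<Rightarrow> bool" where
  "eternal8 rel \<longleftrightarrow> (\<forall>G. group G \<and> finite (carrier G) \<longrightarrow>
     (\<forall>H K. subgroup K G \<and> subgroup H G \<and> H \<subseteq> K \<and> rel H G \<longrightarrow> rel H (G\<lparr>carrier := K\<rparr>)) \<and>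
     (\<forall>p. Factorial_Ring.prime p \<and> p dvd order G \<longrightarrow>
        (\<exists>D. subgroup D G \<and> D \<subseteq> p_core p G \<and> 1 < card D \<and> card D < card (p_core p G) \<and>
           (\<forall>H. subgroup H G \<and> H \<subseteq> p_core p G \<and> card H = card D \<longrightarrow> rel H G) \<and>
           (\<not> comm_group (G\<lparr>carrier := p_core p G\<rparr>) \<and> is_p_subgroup 2 G (p_core p G) \<and>
              card (rcosets\<^bsub>G\<lparr>carrier := p_core p G\<rparr>\<^esub> D) > 2 \<longrightarrow>
              (\<forall>H. subgroup H G \<and> H \<subseteq> p_core p G \<and> cyclic_group (G\<lparr>carrier := H\<rparr>) \<and>
                 card H = 2 * card D \<longrightarrow> rel H G)))
        \<longrightarrow> p_core p G \<subseteq> supersolvable_hypercenter G))"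

(* A fusion system on a p-group S is given by its morphism sets F P Q for subgroups P, Q of S. The
   morphisms are functions restricted to P (undefined outside P). Conjugation acts
   on the right: x^g = g^-1 x g. *)
type_synonym 'a fusion = "'a set \<Rightarrow> 'a set \<Rightarrow> ('a \<Rightarrow> 'a) set"

definition group_fusion :: "('a, 'b) monoid_scheme \<Rightarrow> 'a set \<Rightarrow> 'a fusion" where
  "group_fusion G S P Q =
     {restrict (\<lambda>x. inv\<^bsub>G\<^esub> g \<otimes>\<^bsub>G\<^esub> x \<otimes>\<^bsub>G\<^esub> g) P | g.
        g \<in> carrier G \<and> subgroup P (G\<lparr>carrier := S\<rparr>) \<and> subgroup Q (G\<lparr>carrier := S\<rparr>) \<and>
        (\<lambda>x. inv\<^bsub>G\<^esub> g \<otimes>\<^bsub>G\<^esub> x \<otimes>\<^bsub>G\<^esub> g) ` P \<subseteq> Q}"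

definition strongly_closed :: "('a, 'b) monoid_scheme \<Rightarrow> 'a fusion \<Rightarrow> 'a set \<Rightarrow> bool" where
  "strongly_closed S F T \<longleftrightarrow> subgroup T S \<and>
     (\<forall>P \<phi>. subgroup P S \<and> P \<subseteq> T \<and> \<phi> \<in> F P (carrier S) \<longrightarrow> \<phi> ` P \<subseteq> T)"

(* The normality clause is implicit in the quotient. It is automatic in any fusion system F on S:
   F contains the inner automorphisms of S, so strongly closed subgroups are normal in S. *)
definition supersolvable_fusion :: "('a, 'b) monoid_scheme \<Rightarrow> 'a fusion \<Rightarrow> bool" where
  "supersolvable_fusion S F \<longleftrightarrow> (\<exists>n (T :: nat \<Rightarrow> 'a set).
     T 0 = {\<one>\<^bsub>S\<^esub>} \<and> T n = carrier S \<and> (\<forall>i\<le>n. strongly_closed S F (T i)) \<and>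
     (\<forall>i<n. T i \<subseteq> T (Suc i) \<and> T i \<lhd> S\<lparr>carrier := T (Suc i)\<rparr> \<and>
        cyclic_group (S\<lparr>carrier := T (Suc i)\<rparr> Mod T i)))"

end

theory Submission
  imports Defs "HOL-Algebra.Sylow" "HOL-Algebra.Group_Action" "HOL-Algebra.Zassenhaus"
    "HOL-Algebra.SndIsomorphismGrp" "HOL-Number_Theory.Residues"
begin

text \<open>The fusion system on \<open>S\<close> is controlled by \<open>N(S)\<close>: if \<open>P\<close> and \<open>P\<^sup>g\<close> lie in \<open>S\<close>, some
  \<open>n\<close> in \<open>N(S)\<close> agrees with \<open>g\<close> on \<open>P\<close>. By downward induction on \<open>|P|\<close> and Sylow's theorem one may
  assume that \<open>g\<close> normalizes \<open>P < S\<close> and that \<open>T = N\<^sub>S(P)\<close> is a Sylow subgroup of \<open>N(P)\<close>; it then suffices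
  to find \<open>c\<close> in \<open>C(P)\<close> such that \<open>gc\<close> normalizes some \<open>U\<close> with \<open>P < U \<le> S\<close>.
  If \<open>|P| \<le> |D|\<close>, then \<open>P\<close> lies in an abelian subgroup of \<open>S\<close> of order \<open>p|D|\<close>, so that
  \<open>U = T \<inter> C(P) > P\<close>, and \<open>c\<close> is given by the Frattini argument.
  If \<open>|P| > |D|\<close>, then \<open>P\<close> lies in the supersolvable hypercenter of \<open>N(P)\<close> because the relation is
  8-eternal. The centralizer in \<open>N(P)\<close> of all chief factors below \<open>P\<close> is then \<open>C(P)T\<close> and contains every
  \<open>p\<close>-element, and the Frattini argument gives \<open>c\<close> for \<open>U = T\<close>.
  Finally \<open>S\<close> itself lies in the supersolvable hypercenter of \<open>N(S)\<close>, and the members of a chief series of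
  \<open>N(S)\<close> below \<open>S\<close> are strongly closed.\<close>

subsection \<open>Conjugation, normalizers and centralizers\<close>

locale fin_group = group +
  assumes fin [simp, intro]: "finite (carrier G)"

lemma fin_groupI: "group G \<Longrightarrow> finite (carrier G) \<Longrightarrow> fin_group G"
  by (simp add: fin_group_def fin_group_axioms_def)

lemma (in fin_group) fin_group_subgroup: "subgroup H G \<Longrightarrow> fin_group (G\<lparr>carrier := H\<rparr>)"
  by (rule fin_groupI) (auto intro: subgroup.subgroup_is_group finite_subset dest: subgroup.subset)

lemma (in fin_group) finite_subgroup: "subgroup H G \<Longrightarrow> finite H"
  by (meson fin finite_subset subgroup.subset)

lemma (in fin_group) card_subgroup_pos: "subgroup H G \<Longrightarrow> 0 < card H"
  by (metis card_gt_0_iff empty_iff finite_subgroup subgroup.one_closed)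

lemma (in group) subgroup_subgroup_iff:
  assumes "subgroup K G"
  shows "subgroup H (G\<lparr>carrier := K\<rparr>) \<longleftrightarrow> subgroup H G \<and> H \<subseteq> K"
proof
  assume "subgroup H (G\<lparr>carrier := K\<rparr>)"
  then show "subgroup H G \<and> H \<subseteq> K" using assms incl_subgroup subgroup.subset[of H "G\<lparr>carrier := K\<rparr>"] by simp
qed (use assms subgroup_incl in blast)

lemma (in fin_group) card_subgroup_dvd:
  assumes "subgroup H G" "subgroup K G" "H \<subseteq> K"
  shows "card H dvd card K"
proof -
  interpret K: fin_group "G\<lparr>carrier := K\<rparr>" using assms fin_group_subgroup by blast
  have "subgroup H (G\<lparr>carrier := K\<rparr>)" using assms by (simp add: subgroup_subgroup_iff)
  from K.lagrange[OF this] show ?thesis unfolding order_def by (metis dvd_triv_right partial_object.select_convs(1) partial_object.update_convs(1) partial_object.surjective)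
qed

lemma (in fin_group) subgroup_card_eq:
  assumes "subgroup K G" "H \<subseteq> K" "card H \<ge> card K"
  shows "H = K"
  using assms card_seteq finite_subgroup by blast

text \<open>The right action \<open>x^g\<close>, with the same formula as in
  \<open>group_fusion\<close>; a product \<open>g \<otimes> h\<close> therefore acts by
  \<open>g\<close> first.\<close>

definition conjg :: "('a, 'b) monoid_scheme \<Rightarrow> 'a \<Rightarrow> 'a \<Rightarrow> 'a" where
  "conjg G g x = inv\<^bsub>G\<^esub> g \<otimes>\<^bsub>G\<^esub> x \<otimes>\<^bsub>G\<^esub> g"

definition normalizer_of :: "('a, 'b) monoid_scheme \<Rightarrow> 'a set \<Rightarrow> 'a set" where
  "normalizer_of G H = {g \<in> carrier G. conjg G g ` H = H}"

definition centralizer_of :: "('a, 'b) monoid_scheme \<Rightarrow> 'a set \<Rightarrow> 'a set" where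
  "centralizer_of G H = {g \<in> carrier G. \<forall>x\<in>H. conjg G g x = x}"

context group
begin

lemma conjg_closed [simp, intro]:
  "g \<in> carrier G \<Longrightarrow> x \<in> carrier G \<Longrightarrow> conjg G g x \<in> carrier G"
  by (simp add: conjg_def)

lemma conjg_mult:
  "\<lbrakk>g \<in> carrier G; x \<in> carrier G; y \<in> carrier G\<rbrakk> \<Longrightarrow> conjg G g (x \<otimes> y) = conjg G g x \<otimes> conjg G g y"
proof -
  assume *: "g \<in> carrier G" "x \<in> carrier G" "y \<in> carrier G"
  then have "g \<otimes> (inv g \<otimes> (y \<otimes> g)) = y \<otimes> g" by (simp flip: m_assoc)
  with * show ?thesis by (simp add: conjg_def m_assoc)
qed

lemma conjg_one [simp]: "g \<in> carrier G \<Longrightarrow> conjg G g \<one> = \<one>"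
  by (simp add: conjg_def)

lemma conjg_by_one [simp]: "x \<in> carrier G \<Longrightarrow> conjg G \<one> x = x"
  by (simp add: conjg_def)

lemma conjg_conjg:
  "\<lbrakk>g \<in> carrier G; h \<in> carrier G; x \<in> carrier G\<rbrakk> \<Longrightarrow> conjg G h (conjg G g x) = conjg G (g \<otimes> h) x"
  by (simp add: conjg_def inv_mult_group m_assoc)

lemma conjg_inv_left [simp]:
  "\<lbrakk>g \<in> carrier G; x \<in> carrier G\<rbrakk> \<Longrightarrow> conjg G (inv g) (conjg G g x) = x"
  by (simp add: conjg_conjg)

lemma conjg_inv_right [simp]:
  "\<lbrakk>g \<in> carrier G; x \<in> carrier G\<rbrakk> \<Longrightarrow> conjg G g (conjg G (inv g) x) = x"
  by (simp add: conjg_conjg)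

lemma conjg_hom: "g \<in> carrier G \<Longrightarrow> group_hom G G (conjg G g)"
  by (simp add: group_hom_def group_hom_axioms_def is_group hom_def conjg_mult)

lemma conjg_int_pow:
  "\<lbrakk>g \<in> carrier G; x \<in> carrier G\<rbrakk> \<Longrightarrow> conjg G g (x [^] (i::int)) = conjg G g x [^] i"
  using group_hom.hom_int_pow[OF conjg_hom] by auto

lemma conjg_nat_pow:
  "\<lbrakk>g \<in> carrier G; x \<in> carrier G\<rbrakk> \<Longrightarrow> conjg G g (x [^] (i::nat)) = conjg G g x [^] i"
  using group_hom.hom_nat_pow[OF conjg_hom] by auto

lemma inj_on_conjg: "g \<in> carrier G \<Longrightarrow> H \<subseteq> carrier G \<Longrightarrow> inj_on (conjg G g) H"
  by (rule inj_on_inverseI[where g = "conjg G (inv g)"]) auto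

lemma card_conjg: "g \<in> carrier G \<Longrightarrow> H \<subseteq> carrier G \<Longrightarrow> card (conjg G g ` H) = card H"
  by (simp add: card_image inj_on_conjg)

lemma subgroup_conjg: "g \<in> carrier G \<Longrightarrow> subgroup H G \<Longrightarrow> subgroup (conjg G g ` H) G"
  using group_hom.subgroup_img_is_subgroup conjg_hom by blast

lemma conjg_subset: "g \<in> carrier G \<Longrightarrow> H \<subseteq> carrier G \<Longrightarrow> conjg G g ` H \<subseteq> carrier G"
  by auto

lemma conjg_image_conjg:
  "\<lbrakk>g \<in> carrier G; h \<in> carrier G; H \<subseteq> carrier G\<rbrakk> \<Longrightarrow> conjg G h ` conjg G g ` H = conjg G (g \<otimes> h) ` H"
  unfolding image_image by (intro image_cong) (auto simp: conjg_conjg)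

lemma conjg_image_one: "H \<subseteq> carrier G \<Longrightarrow> conjg G \<one> ` H = H"
  using conjg_by_one by (metis (mono_tags, lifting) image_cong image_ident subset_iff)

lemma conjg_consistent:
  "\<lbrakk>subgroup K G; g \<in> K\<rbrakk> \<Longrightarrow> conjg (G\<lparr>carrier := K\<rparr>) g x = conjg G g x"
  by (simp add: conjg_def m_inv_consistent)

lemma conjg_mem_subgroup:
  "\<lbrakk>subgroup H G; g \<in> H; x \<in> H\<rbrakk> \<Longrightarrow> conjg G g x \<in> H"
  by (simp add: conjg_def subgroup.m_closed subgroup.m_inv_closed)

lemma subgroup_conjg_self:
  assumes "subgroup H G" "g \<in> H" shows "conjg G g ` H = H"
proof
  show "conjg G g ` H \<subseteq> H" using assms conjg_mem_subgroup by blast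
  show "H \<subseteq> conjg G g ` H"
  proof
    fix x assume "x \<in> H"
    then have "conjg G (inv g) x \<in> H" "x \<in> carrier G" "g \<in> carrier G"
      using assms conjg_mem_subgroup subgroup.m_inv_closed[OF assms] subgroup.mem_carrier[OF assms(1)] by blast+
    then show "x \<in> conjg G g ` H" by (metis conjg_inv_right imageI)
  qed
qed

lemma normal_conjg_iff:
  "N \<lhd> G \<longleftrightarrow> subgroup N G \<and> (\<forall>g\<in>carrier G. \<forall>x\<in>N. conjg G g x \<in> N)"
  unfolding normal_inv_iff conjg_def by (metis inv_closed inv_inv)

lemma normal_conjg_image:
  assumes "N \<lhd> G" "g \<in> carrier G" shows "conjg G g ` N = N"
proof
  have N: "N \<subseteq> carrier G" using assms normal_imp_subgroup subgroup.subset by blast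
  show "conjg G g ` N \<subseteq> N" using assms normal_conjg_iff by blast
  show "N \<subseteq> conjg G g ` N"
  proof
    fix x assume "x \<in> N"
    then have "conjg G (inv g) x \<in> N" "x \<in> carrier G" using assms normal_conjg_iff N by auto
    then show "x \<in> conjg G g ` N" by (metis assms(2) conjg_inv_right imageI)
  qed
qed

lemma subgroup_normalizer_of: 
  assumes "H \<subseteq> carrier G" shows "subgroup (normalizer_of G H) G"
proof (rule subgroupI)
  show "normalizer_of G H \<noteq> {}" using conjg_image_one[OF assms] by (auto simp: normalizer_of_def)
next
  fix g assume g: "g \<in> normalizer_of G H"
  then have "conjg G (inv g) ` conjg G g ` H = H"
    using assms by (subst conjg_image_conjg) (auto simp: normalizer_of_def conjg_image_one)
  with g show "inv g \<in> normalizer_of G H" by (auto simp: normalizer_of_def)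
next
  fix g h assume "g \<in> normalizer_of G H" "h \<in> normalizer_of G H"
  with assms show "g \<otimes> h \<in> normalizer_of G H" by (auto simp: normalizer_of_def simp flip: conjg_image_conjg)
qed (auto simp: normalizer_of_def)

lemma subgroup_centralizer_of: 
  assumes "H \<subseteq> carrier G" shows "subgroup (centralizer_of G H) G"
proof (rule subgroupI)
  show "centralizer_of G H \<noteq> {}" using assms conjg_by_one one_closed unfolding centralizer_of_def by blast
next
  fix g assume g: "g \<in> centralizer_of G H"
  then have "conjg G (inv g) x = x" if "x \<in> H" for x
    using assms that conjg_inv_left[of g x] by (auto simp: centralizer_of_def)
  with g show "inv g \<in> centralizer_of G H" by (auto simp: centralizer_of_def)
next
  fix g h assume "g \<in> centralizer_of G H" "h \<in> centralizer_of G H"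
  with assms show "g \<otimes> h \<in> centralizer_of G H" by (auto simp: centralizer_of_def subset_iff simp flip: conjg_conjg)
qed (auto simp: centralizer_of_def)

lemma normalizer_ofD: "g \<in> normalizer_of G H \<Longrightarrow> g \<in> carrier G" "g \<in> normalizer_of G H \<Longrightarrow> conjg G g ` H = H"
  by (auto simp: normalizer_of_def)

lemma subgroup_subset_normalizer_of: "subgroup H G \<Longrightarrow> H \<subseteq> normalizer_of G H"
  using subgroup_conjg_self subgroup.mem_carrier by (fastforce simp: normalizer_of_def)

lemma normal_normalizer_of:
  assumes "subgroup H G" shows "H \<lhd> G\<lparr>carrier := normalizer_of G H\<rparr>"
proof -
  have s: "subgroup (normalizer_of G H) G" using assms subgroup_normalizer_of subgroup.subset by blast
  interpret N: group "G\<lparr>carrier := normalizer_of G H\<rparr>" using s subgroup.subgroup_is_group is_group by blast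
  show ?thesis unfolding N.normal_conjg_iff
    using assms s subgroup_subset_normalizer_of[OF assms] by (auto simp: subgroup_subgroup_iff conjg_consistent normalizer_of_def)
qed

end

text \<open>Conjugation is injective, so in a finite group the inclusion is already an
  equality.\<close>

lemma (in fin_group) normalizer_ofI:
  "\<lbrakk>g \<in> carrier G; H \<subseteq> carrier G; conjg G g ` H \<subseteq> H\<rbrakk> \<Longrightarrow> g \<in> normalizer_of G H"
  unfolding normalizer_of_def using card_conjg[of g H] by (simp add: card_subset_eq finite_subset[OF _ fin])

section \<open>Fixed points of actions of p-groups\<close>

lemma dvd_prime_power_nat:
  fixes p :: nat assumes "Factorial_Ring.prime p" "m dvd p ^ n" shows "\<exists>k. m = p ^ k"
  using assms divides_primepow_nat by blast

text \<open>The points that are not fixed fall into orbits whose lengths divide \<open>p ^ n\<close>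
  and exceed 1, hence are multiples of \<open>p\<close>.\<close>

theorem (in group_action) card_fixed_points_mod:
  fixes p :: nat
  assumes p: "Factorial_Ring.prime p" and G: "order G = p ^ n" and E: "finite E"
  shows "card {x \<in> E. \<forall>g\<in>carrier G. \<phi> g x = x} mod p = card E mod p"
proof -
  let ?F = "{x \<in> E. \<forall>g\<in>carrier G. \<phi> g x = x}"
  interpret group G using group_hom by (simp add: group_hom_def)
  have refl: "x \<in> orbit G \<phi> x" if "x \<in> E" for x using that orbit_refl by blast
  have orb: "orbit G \<phi> x \<subseteq> E" if "x \<in> E" for x using that element_image by (auto simp: orbit_def)
  let ?C = "orbit G \<phi> ` (E - ?F)"
  have disj: "orbit G \<phi> x = orbit G \<phi> y" if "x \<in> E" "y \<in> E" "z \<in> orbit G \<phi> x" "z \<in> orbit G \<phi> y" for x y z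
    using that disjoint_union[of "orbit G \<phi> x" "orbit G \<phi> y"] by (auto simp: orbits_def)
  have fixed: "orbit G \<phi> x = {x}" if "x \<in> ?F" for x
    using that refl[of x] by (auto simp: orbit_def)
  have U: "\<Union>?C = E - ?F"
  proof
    show "E - ?F \<subseteq> \<Union>?C" using refl by blast
    show "\<Union>?C \<subseteq> E - ?F"
    proof
      fix z assume "z \<in> \<Union>?C"
      then obtain x where x: "x \<in> E - ?F" "z \<in> orbit G \<phi> x" by blast
      have z: "z \<in> E" using x orb by blast
      have "z \<notin> ?F"
      proof
        assume zF: "z \<in> ?F"
        have "orbit G \<phi> x = {z}" using disj[of x z z] x z refl fixed[OF zF] by blast
        then have "x = z" using refl x by blast
        then show False using x zF by blast
      qed
      with z show "z \<in> E - ?F" by blast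
    qed
  qed
  have "p dvd card (\<Union>?C)"
  proof (rule dvd_partition)
    show "finite (\<Union>?C)" using E by (subst U) auto
    show "\<forall>c\<in>?C. p dvd card c"
    proof
      fix c assume "c \<in> ?C"
      then obtain x where x: "x \<in> E" "x \<notin> ?F" and c: "c = orbit G \<phi> x" by blast
      have "card c dvd p ^ n" using orbit_stabilizer_theorem[OF x(1)] G c by (metis dvd_triv_left)
      then obtain k where k: "card c = p ^ k" using dvd_prime_power_nat[OF p] by blast
      \<comment> \<open>An orbit of length \<open>p ^ 0\<close> consists of \<open>x\<close> alone,
        and \<open>x\<close> would be a fixed point.\<close>
      show "p dvd card c"
      proof (cases k)
        case 0
        then have "card c = 1" using k by simp
        then obtain y where "c = {y}" by (auto simp: card_1_singleton_iff)
        then have "c = {x}" using refl[OF x(1)] c by simp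
        then have "x \<in> ?F" using x c by (auto simp: orbit_def)
        then show ?thesis using x by blast
      qed (use k in simp)
    qed
    show "\<forall>c1\<in>?C. \<forall>c2\<in>?C. c1 \<noteq> c2 \<longrightarrow> c1 \<inter> c2 = {}" using disj by blast
  qed
  then have "p dvd card (E - ?F)" by (simp add: U)
  moreover have "card E = card ?F + card (E - ?F)"
    using E card_Diff_subset[of ?F E] card_mono[of E ?F] by auto
  ultimately show ?thesis by (auto elim!: dvdE)
qed

subsection \<open>Sylow's theorems\<close>

text \<open>Multiplication of right cosets from the right is a right action; multiplying by
  \<open>inv q\<close> turns it into a left action, as \<open>group_action\<close> demands.\<close>

lemma (in group) rcosets_right_mult_action:
  assumes H: "subgroup H G" and Q: "subgroup Q G"
  shows "group_action (G\<lparr>carrier := Q\<rparr>) (rcosets H) (\<lambda>q. \<lambda>X\<in>rcosets H. X #> inv q)"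
proof -
  let ?E = "rcosets H" and ?\<phi> = "\<lambda>q. \<lambda>X\<in>rcosets H. X #> inv q"
  have HG: "H \<subseteq> carrier G" and QG: "Q \<subseteq> carrier G" using assms subgroup.subset by blast+
  have sub: "X \<subseteq> carrier G" if "X \<in> ?E" for X
    using that H rcosets_subset_PowG by blast
  have cl: "X #> g \<in> ?E" if X: "X \<in> ?E" and g: "g \<in> carrier G" for X g
  proof -
    obtain a where a: "a \<in> carrier G" "X = H #> a" using X by (auto simp: RCOSETS_def)
    then have "X #> g = H #> (a \<otimes> g)" using HG g by (simp add: coset_mult_assoc)
    then show ?thesis using rcosetsI[OF HG, of "a \<otimes> g"] a g by simp
  qed
  have bij: "?\<phi> q \<in> Bij ?E" if q: "q \<in> carrier G" for q
  proof -
    have "bij_betw (?\<phi> q) ?E ?E"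
    proof (rule bij_betw_byWitness[where f' = "\<lambda>X. X #> q"])
      show "\<forall>X\<in>?E. ?\<phi> q X #> q = X" using q sub by (simp add: coset_mult_assoc)
      show "\<forall>X\<in>?E. ?\<phi> q (X #> q) = X" using q sub cl by (simp add: coset_mult_assoc)
    qed (use q cl in auto)
    then show ?thesis by (simp add: Bij_def)
  qed
  have "group_hom (G\<lparr>carrier := Q\<rparr>) (BijGroup ?E) ?\<phi>"
  proof (intro group_hom.intro group_hom_axioms.intro)
    show "group (G\<lparr>carrier := Q\<rparr>)" using Q is_group subgroup.subgroup_is_group by blast
    show "group (BijGroup ?E)" by (rule group_BijGroup)
    show "?\<phi> \<in> hom (G\<lparr>carrier := Q\<rparr>) (BijGroup ?E)"
    proof (rule homI)
      fix q assume "q \<in> carrier (G\<lparr>carrier := Q\<rparr>)"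
      then show "?\<phi> q \<in> carrier (BijGroup ?E)" using bij QG by (auto simp: BijGroup_def)
    next
      fix q r assume "q \<in> carrier (G\<lparr>carrier := Q\<rparr>)" "r \<in> carrier (G\<lparr>carrier := Q\<rparr>)"
      then have q: "q \<in> carrier G" and r: "r \<in> carrier G" using QG by auto
      have "?\<phi> (q \<otimes> r) = compose ?E (?\<phi> q) (?\<phi> r)"
        using q r cl sub by (intro ext) (auto simp: compose_def inv_mult_group coset_mult_assoc)
      then show "?\<phi> (q \<otimes>\<^bsub>G\<lparr>carrier := Q\<rparr>\<^esub> r) = ?\<phi> q \<otimes>\<^bsub>BijGroup ?E\<^esub> ?\<phi> r"
        using bij[OF q] bij[OF r] by (simp add: BijGroup_def)
    qed
  qed
  then show ?thesis by (simp add: group_action_def)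
qed

theorem (in fin_group) card_fixed_rcosets_mod:
  fixes p :: nat
  assumes p: "Factorial_Ring.prime p" and H: "subgroup H G" and Q: "subgroup Q G" and cQ: "card Q = p ^ n"
  shows "card {X \<in> rcosets H. \<forall>q\<in>Q. X #> inv q = X} mod p = card (rcosets H) mod p"
proof -
  interpret A: group_action "G\<lparr>carrier := Q\<rparr>" "rcosets H" "\<lambda>q. \<lambda>X\<in>rcosets H. X #> inv q"
    using H Q by (rule rcosets_right_mult_action)
  have fin: "finite (rcosets H)" by (simp add: RCOSETS_def)
  have "card {X \<in> rcosets H. \<forall>q\<in>carrier (G\<lparr>carrier := Q\<rparr>). (\<lambda>X\<in>rcosets H. X #> inv q) X = X} mod p
      = card (rcosets H) mod p"
    by (rule A.card_fixed_points_mod[OF p _ fin]) (use cQ in \<open>simp add: order_def\<close>)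
  moreover have "{X \<in> rcosets H. \<forall>q\<in>carrier (G\<lparr>carrier := Q\<rparr>). (\<lambda>X\<in>rcosets H. X #> inv q) X = X}
    = {X \<in> rcosets H. \<forall>q\<in>Q. X #> inv q = X}" by auto
  ultimately show ?thesis by simp
qed

text \<open>From \<open>g \<otimes> q = h \<otimes> g\<close> with \<open>h\<close> in
  \<open>H\<close> one gets \<open>g q g^-1 = h\<close>; as conjugation acts on the right, this is
  the conjugate of \<open>q\<close> by \<open>inv g\<close>.\<close>

lemma (in group) rcoset_fixed_imp_conjg:
  assumes H: "subgroup H G" and g: "g \<in> carrier G" and q: "q \<in> carrier G"
    and eq: "(H #> g) #> inv q = H #> g"
  shows "conjg G (inv g) q \<in> H"
proof -
  have HG: "H \<subseteq> carrier G" using H subgroup.subset by blast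
  have "H #> g = ((H #> g) #> inv q) #> q" using HG g q by (simp add: coset_mult_assoc m_assoc)
  then have "H #> g = H #> (g \<otimes> q)" using eq HG g q by (simp add: coset_mult_assoc)
  then have "g \<otimes> q \<in> H #> g" using rcos_self[OF _ H, of "g \<otimes> q"] g q by simp
  then obtain h where h: "h \<in> H" "g \<otimes> q = h \<otimes> g" by (auto simp: r_coset_def)
  then have "h = g \<otimes> q \<otimes> inv g" using g q HG by (simp add: m_assoc subset_eq)
  then show ?thesis using h g by (simp add: conjg_def)
qed

text \<open>\<open>Q\<close> acts on the cosets of \<open>H\<close>. Their number is not divisible
  by \<open>p\<close>, so some coset \<open>H #> g\<close> is fixed by all of \<open>Q\<close>, and
  \<open>inv g\<close> conjugates \<open>Q\<close> into \<open>H\<close>.\<close>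

theorem (in fin_group) p_subgroup_conjugate_into:
  fixes p :: nat
  assumes p: "Factorial_Ring.prime p" and H: "subgroup H G" and Q: "subgroup Q G" and cQ: "card Q = p ^ n"
    and ndvd: "\<not> p dvd card (rcosets H)"
  obtains g where "g \<in> carrier G" "conjg G g ` Q \<subseteq> H"
proof -
  have "card {X \<in> rcosets H. \<forall>q\<in>Q. X #> inv q = X} mod p \<noteq> 0"
    using ndvd card_fixed_rcosets_mod[OF p H Q cQ] by (simp add: dvd_eq_mod_eq_0)
  then have "{X \<in> rcosets H. \<forall>q\<in>Q. X #> inv q = X} \<noteq> {}" by (metis card.empty mod_0)
  then obtain X where X: "X \<in> rcosets H" "\<forall>q\<in>Q. X #> inv q = X" by blast
  then obtain g where g: "g \<in> carrier G" "\<forall>q\<in>Q. (H #> g) #> inv q = H #> g" unfolding RCOSETS_def by blast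
  have "conjg G (inv g) ` Q \<subseteq> H"
    using rcoset_fixed_imp_conjg[OF H g(1)] g(2) subgroup.mem_carrier[OF Q] by blast
  then show thesis using that[of "inv g"] g by simp
qed

theorem (in fin_group) sylow_subgroup_exists:
  assumes p: "Factorial_Ring.prime p"
  obtains S where "sylow_subgroup p G S"
proof -
  have "p ^ multiplicity p (order G) dvd order G" by (rule multiplicity_dvd)
  then obtain m where m: "order G = p ^ multiplicity p (order G) * m" by blast
  from sylow_thm[OF p is_group m fin] show thesis
    using that by (auto simp: sylow_subgroup_def)
qed

lemma (in fin_group) order_pos: "0 < order G"
  by (simp add: order_gt_0_iff_finite)

lemma (in fin_group) p_subgroup_le_sylow:
  fixes p :: nat
  assumes p: "Factorial_Ring.prime p" and S: "sylow_subgroup p G S" and Q: "subgroup Q G" and cQ: "card Q = p ^ n"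
  shows "card Q dvd card S"
proof -
  have "card Q dvd order G" using Q lagrange by (metis dvd_triv_right)
  then have "n \<le> multiplicity p (order G)"
    using cQ p order_pos by (metis multiplicity_geI less_numeral_extra(3) not_prime_unit)
  then show ?thesis using cQ S by (simp add: sylow_subgroup_def le_imp_power_dvd)
qed

theorem (in fin_group) sylow_conjugate:
  fixes p :: nat
  assumes p: "Factorial_Ring.prime p" and S: "sylow_subgroup p G S" and Q: "subgroup Q G" and cQ: "card Q = p ^ n"
  obtains g where "g \<in> carrier G" "conjg G g ` Q \<subseteq> S"
proof -
  have S': "subgroup S G" "card S = p ^ multiplicity p (order G)" using S by (auto simp: sylow_subgroup_def)
  have "\<not> p dvd card (rcosets S)"
  proof
    assume "p dvd card (rcosets S)"
    then have "p ^ Suc (multiplicity p (order G)) dvd order G"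
      using lagrange[OF S'(1)] S'(2) by (metis mult_dvd_mono dvd_refl power_Suc)
    then show False
      using power_dvd_iff_le_multiplicity[of "order G" p "Suc (multiplicity p (order G))"] order_pos p
        prime_gt_1_nat[OF p] by auto
  qed
  then show thesis using p_subgroup_conjugate_into[OF p S'(1) Q cQ] that by blast
qed

lemma (in fin_group) sylow_card_ge:
  fixes p :: nat
  assumes p: "Factorial_Ring.prime p" and S: "sylow_subgroup p G S" and Q: "subgroup Q G" and cQ: "card Q = p ^ n"
    and "card S \<le> card Q"
  shows "sylow_subgroup p G Q"
proof -
  have "card Q dvd card S" by (rule p_subgroup_le_sylow[OF p S Q cQ])
  then have "card Q = card S" using assms(5) card_subgroup_pos S
    by (metis dvd_imp_le le_antisym sylow_subgroup_def)
  then show ?thesis using S Q by (simp add: sylow_subgroup_def)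
qed

lemma (in fin_group) normal_p_subgroup_le_sylow:
  fixes p :: nat
  assumes p: "Factorial_Ring.prime p" and S: "sylow_subgroup p G S" and Q: "Q \<lhd> G" and cQ: "card Q = p ^ n"
  shows "Q \<subseteq> S"
proof -
  obtain g where "g \<in> carrier G" "conjg G g ` Q \<subseteq> S"
    using sylow_conjugate[OF p S normal_imp_subgroup[OF Q] cQ] .
  then show ?thesis using normal_conjg_image[OF Q] by simp
qed

text \<open>Let \<open>H\<close> act on its own cosets. The index is a multiple of \<open>p\<close>,
  hence so is the number of fixed cosets; as \<open>H\<close> itself is fixed, there is a second
  fixed coset \<open>H #> g\<close>, and \<open>g\<close> normalizes \<open>H\<close>.\<close>

theorem (in fin_group) p_group_normalizer_grows:
  fixes p :: nat
  assumes p: "Factorial_Ring.prime p" and o: "order G = p ^ n" and H: "subgroup H G" and ne: "H \<noteq> carrier G"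
  obtains g where "g \<in> normalizer_of G H" "g \<notin> H"
proof -
  have HG: "H \<subseteq> carrier G" using H subgroup.subset by blast
  obtain m where cH: "card H = p ^ m" using dvd_prime_power_nat[OF p] lagrange[OF H] o by (metis dvd_triv_right)
  have "card (rcosets H) \<noteq> 1"
  proof
    assume "card (rcosets H) = 1"
    then have "card H = card (carrier G)" using lagrange[OF H] by (simp add: order_def)
    then show False using ne HG card_subset_eq[OF fin HG] by simp
  qed
  moreover have "card (rcosets H) dvd p ^ n" using lagrange[OF H] o by (metis dvd_triv_left)
  ultimately have "p dvd card (rcosets H)" using dvd_prime_power_nat[OF p]
    by (metis power_0 dvd_power less_nat_zero_code not_gr_zero)
  then have d: "p dvd card {X \<in> rcosets H. \<forall>q\<in>H. X #> inv q = X}" (is "p dvd card ?F")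
    using card_fixed_rcosets_mod[OF p H H cH] by (simp add: dvd_eq_mod_eq_0)
  have HF: "H \<in> ?F"
    using H subgroup.subgroup_in_rcosets[OF H is_group] by (auto simp: coset_join2 subgroup.m_inv_closed subgroup.mem_carrier)
  have "?F \<noteq> {H}" using d p by (auto simp: not_prime_1)
  then obtain X where X: "X \<in> rcosets H" "\<forall>q\<in>H. X #> inv q = X" "X \<noteq> H" using HF by blast
  then obtain g where g: "g \<in> carrier G" "X = H #> g" by (auto simp: RCOSETS_def)
  have gH: "g \<notin> H" using X g H coset_join2 by auto
  have "conjg G (inv g) ` H \<subseteq> H"
    using rcoset_fixed_imp_conjg[OF H g(1)] X g HG by blast
  then have "inv g \<in> normalizer_of G H" using normalizer_ofI g HG by simp
  then show thesis using that[of "inv g"] gH H g by (metis inv_inv subgroup.m_inv_closed)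
qed

subsection \<open>Normal \<open>p\<close>-subgroups and the \<open>p\<close>-core\<close>

text \<open>Take the preimage of a subgroup of order \<open>p\<close> of the quotient by
  \<open>R\<close>; the preimage of a set of cosets is their union.\<close>

lemma (in fin_group) normal_overgroup_prime_index:
  fixes p :: nat
  assumes p: "Factorial_Ring.prime p" and R: "R \<lhd> G" and d: "p dvd card (rcosets R)"
  obtains H where "subgroup H G" "R \<subseteq> H" "card H = p * card R"
proof -
  interpret R: normal R G by (rule R)
  interpret Q: group "G Mod R" by (rule R.factorgroup_is_group)
  have Qfin: "finite (carrier (G Mod R))" by (simp add: carrier_FactGroup)
  have "order (G Mod R) = card (rcosets R)" by (simp add: order_def FactGroup_def)
  \<comment> \<open>The exponent 1 turns Sylow's theorem into Cauchy's theorem for the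
    quotient.\<close>
  then obtain m where "order (G Mod R) = p ^ 1 * m" using d by auto
  from sylow_thm[OF p Q.is_group this Qfin]
  obtain X where X: "subgroup X (G Mod R)" "card X = p" by auto
  define H where "H = \<Union>X"
  have H: "subgroup H G" unfolding H_def using X(1) R.factgroup_subgroup_union_subgroup by blast
  interpret H: fin_group "G\<lparr>carrier := H\<rparr>" using H fin_group_subgroup by blast
  have RX: "R \<in> X" using subgroup.one_closed[OF X(1)] by simp
  then have RH: "R \<subseteq> H" by (auto simp: H_def)
  have RsH: "subgroup R (G\<lparr>carrier := H\<rparr>)" using RH H R.subgroup_axioms by (simp add: subgroup_subgroup_iff)
  have "X = rcosets\<^bsub>G\<lparr>carrier := H\<rparr>\<^esub> R"
    using R.factgroup_subgroup_union_factor[OF X(1)] by (simp add: H_def)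
  then have "card H = p * card R"
    using H.lagrange[OF RsH] X(2) by (simp add: order_def)
  with H RH show thesis using that by blast
qed

text \<open>\<open>R\<close> is a proper subgroup of its normalizer, so its index there is a
  nontrivial power of \<open>p\<close>.\<close>

lemma (in fin_group) p_group_overgroup_step:
  fixes p :: nat
  assumes p: "Factorial_Ring.prime p" and o: "order G = p ^ n" and R: "subgroup R G" and ne: "R \<noteq> carrier G"
  obtains H where "subgroup H G" "R \<subseteq> H" "card H = p * card R"
proof -
  let ?N = "normalizer_of G R"
  have RG: "R \<subseteq> carrier G" using R subgroup.subset by blast
  have N: "subgroup ?N G" using subgroup_normalizer_of[OF RG] .
  interpret N: fin_group "G\<lparr>carrier := ?N\<rparr>" using N fin_group_subgroup by blast
  have RN: "R \<lhd> G\<lparr>carrier := ?N\<rparr>" using normal_normalizer_of[OF R] .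
  obtain g where g: "g \<in> ?N" "g \<notin> R" using p_group_normalizer_grows[OF p o R ne] .
  have lag: "card (rcosets\<^bsub>G\<lparr>carrier := ?N\<rparr>\<^esub> R) * card R = card ?N"
    using N.lagrange[OF normal_imp_subgroup[OF RN]] by (simp add: order_def)
  have "card ?N dvd p ^ n" using lagrange[OF N] o by (metis dvd_triv_right)
  then have "card (rcosets\<^bsub>G\<lparr>carrier := ?N\<rparr>\<^esub> R) dvd p ^ n" using lag by (metis dvd_mult_left)
  then obtain k where k: "card (rcosets\<^bsub>G\<lparr>carrier := ?N\<rparr>\<^esub> R) = p ^ k" using dvd_prime_power_nat[OF p] by blast
  have "k \<noteq> 0"
  proof
    assume "k = 0"
    then have "card R = card ?N" using k lag by simp
    then have "R = ?N" using subgroup_card_eq[OF N subgroup_subset_normalizer_of[OF R]] by simp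
    then show False using g by blast
  qed
  then have "p dvd card (rcosets\<^bsub>G\<lparr>carrier := ?N\<rparr>\<^esub> R)" using k by simp
  from N.normal_overgroup_prime_index[OF p RN this]
  obtain H where "subgroup H (G\<lparr>carrier := ?N\<rparr>)" "R \<subseteq> H" "card H = p * card R" .
  then show thesis using that N by (auto simp: subgroup_subgroup_iff)
qed

text \<open>Used for an abelian overgroup of order \<open>p * card D\<close> of a small subgroup of
  \<open>S\<close>, and for a subgroup of order \<open>card D\<close> of a \<open>p\<close>-core,
  above the trivial subgroup.\<close>

theorem (in fin_group) p_group_overgroup:
  fixes p :: nat
  assumes p: "Factorial_Ring.prime p" and o: "order G = p ^ n" and R: "subgroup R G" and cR: "card R = p ^ r"
    and "r \<le> k" "k \<le> n"
  obtains H where "subgroup H G" "R \<subseteq> H" "card H = p ^ k"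
proof -
  have "k \<le> n \<longrightarrow> (\<exists>H. subgroup H G \<and> R \<subseteq> H \<and> card H = p ^ k)"
    using \<open>r \<le> k\<close>
  proof (induction k rule: dec_induct)
    case base
    then show ?case using R cR by blast
  next
    case (step k)
    show ?case
    proof
      assume k: "Suc k \<le> n"
      then obtain H where H: "subgroup H G" "R \<subseteq> H" "card H = p ^ k" using step by auto
      have "p ^ k \<noteq> p ^ n" using k prime_gt_1_nat[OF p] by simp
      then have "H \<noteq> carrier G" using H(3) o by (auto simp: order_def)
      from p_group_overgroup_step[OF p o H(1) this] show "\<exists>H. subgroup H G \<and> R \<subseteq> H \<and> card H = p ^ Suc k"
        using H by (metis order_trans power_Suc)
    qed
  qed
  then show thesis using that assms by blast
qed

section \<open>Greatest normal subgroups with a given property\<close>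

lemma (in group) normal_subset: "N \<lhd> G \<Longrightarrow> N \<subseteq> carrier G"
  using normal_imp_subgroup subgroup.subset by blast

lemma (in group) subset_set_mult:
  assumes A: "subgroup A G" and B: "subgroup B G"
  shows "A \<subseteq> A <#> B" "B \<subseteq> A <#> B"
proof -
  have "a \<otimes> \<one> \<in> A <#> B" if "a \<in> A" for a
    using that subgroup.one_closed[OF B] by (force simp: set_mult_def)
  then show "A \<subseteq> A <#> B" using subgroup.mem_carrier[OF A] by auto
  have "\<one> \<otimes> b \<in> A <#> B" if "b \<in> B" for b
    using that subgroup.one_closed[OF A] by (force simp: set_mult_def)
  then show "B \<subseteq> A <#> B" using subgroup.mem_carrier[OF B] by auto
qed

lemma (in group) set_mult_subset_subgroup:
  assumes "subgroup H G" "A \<subseteq> H" "B \<subseteq> H"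
  shows "A <#> B \<subseteq> H"
  using assms subgroup.m_closed[OF assms(1)] by (auto simp: set_mult_def)

text \<open>A normal subgroup \<open>A\<close> of largest order with property \<open>P\<close> is
  the greatest one: for any other such \<open>N\<close> the product \<open>A <#> N\<close> has
  \<open>P\<close> too and contains \<open>A\<close>, so it equals \<open>A\<close>. This makes both
  \<open>p_core\<close> and \<open>supersolvable_hypercenter\<close> well defined.\<close>

lemma (in fin_group) Greatest_normal:
  assumes one: "P {\<one>}"
    and prod: "\<And>A B. \<lbrakk>A \<lhd> G; B \<lhd> G; P A; P B\<rbrakk> \<Longrightarrow> P (A <#> B)"
  defines "M \<equiv> (GREATEST N. N \<lhd> G \<and> P N)"
  shows "M \<lhd> G" "P M" "\<And>N. \<lbrakk>N \<lhd> G; P N\<rbrakk> \<Longrightarrow> N \<subseteq> M"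
proof -
  let ?X = "{N. N \<lhd> G \<and> P N}"
  have "?X \<subseteq> Pow (carrier G)" using normal_subset by blast
  then have "finite ?X" using finite_subset by blast
  moreover have "{\<one>} \<in> ?X" using one one_is_normal by simp
  ultimately have "finite (card ` ?X)" "Max (card ` ?X) \<in> card ` ?X" by (blast, intro Max_in) auto
  then obtain A where A: "A \<in> ?X" "\<And>N. N \<in> ?X \<Longrightarrow> card N \<le> card A"
    using Max_ge[of "card ` ?X"] by (metis (no_types, lifting) imageE imageI)
  have max: "N \<subseteq> A" if "N \<lhd> G" "P N" for N
  proof -
    have AN: "A \<lhd> G" "N \<lhd> G" "P A" "P N" using A that by auto
    then have "A <#> N \<in> ?X" using normal_subgroup_set_mult_closed prod by blast
    then have "card (A <#> N) \<le> card A" using A by blast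
    moreover have "A \<subseteq> A <#> N" "N \<subseteq> A <#> N" using AN subset_set_mult normal_imp_subgroup by blast+
    moreover have "finite (A <#> N)" using normal_subset[OF normal_subgroup_set_mult_closed[OF AN(1,2)]] fin finite_subset by blast
    ultimately show ?thesis using card_seteq by blast
  qed
  have "M = A" unfolding M_def
    by (rule Greatest_equality) (use A max in auto)
  then show "M \<lhd> G" "P M" "\<And>N. \<lbrakk>N \<lhd> G; P N\<rbrakk> \<Longrightarrow> N \<subseteq> M" using A max by auto
qed

text \<open>A normal \<open>p\<close>-subgroup lies in every Sylow subgroup, so \<open>A\<close>,
  \<open>B\<close> and hence their product lie in \<open>S\<close>.\<close>

lemma (in fin_group) is_p_subgroup_set_mult:
  fixes p :: nat
  assumes p: "Factorial_Ring.prime p" and A: "A \<lhd> G" "is_p_subgroup p G A" and B: "B \<lhd> G" "is_p_subgroup p G B"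
  shows "is_p_subgroup p G (A <#> B)"
proof -
  obtain S where S: "sylow_subgroup p G S" using sylow_subgroup_exists[OF p] .
  then have S': "subgroup S G" "card S = p ^ multiplicity p (order G)" by (auto simp: sylow_subgroup_def)
  have "A \<subseteq> S" "B \<subseteq> S"
    using normal_p_subgroup_le_sylow[OF p S] A B by (auto simp: is_p_subgroup_def)
  then have "A <#> B \<subseteq> S" using set_mult_subset_subgroup S' by blast
  moreover have AB: "subgroup (A <#> B) G" using A B normal_subgroup_set_mult_closed normal_imp_subgroup by blast
  ultimately have "card (A <#> B) dvd p ^ multiplicity p (order G)" using card_subgroup_dvd S' by metis
  then show ?thesis using AB dvd_prime_power_nat[OF p] by (auto simp: is_p_subgroup_def)
qed

theorem (in fin_group)
  fixes p :: nat
  assumes p: "Factorial_Ring.prime p"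
  shows p_core_normal: "p_core p G \<lhd> G"
    and p_core_is_p_subgroup: "is_p_subgroup p G (p_core p G)"
    and p_core_greatest: "\<And>N. \<lbrakk>N \<lhd> G; is_p_subgroup p G N\<rbrakk> \<Longrightarrow> N \<subseteq> p_core p G"
proof -
  have "is_p_subgroup p G {\<one>}"
    unfolding is_p_subgroup_def by (auto intro: normal_imp_subgroup one_is_normal exI[of _ 0])
  from Greatest_normal[of "is_p_subgroup p G", OF this is_p_subgroup_set_mult[OF p]]
  show "p_core p G \<lhd> G" "is_p_subgroup p G (p_core p G)"
    "\<And>N. \<lbrakk>N \<lhd> G; is_p_subgroup p G N\<rbrakk> \<Longrightarrow> N \<subseteq> p_core p G"
    unfolding p_core_def by blast+
qed

subsection \<open>The supersolvable hypercenter\<close>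

text \<open>Cyclicity of the quotient of \<open>H\<close> by \<open>K\<close> in terms of elements:
  \<open>a\<close> generates \<open>H\<close> modulo \<open>K\<close>. In this form generators can
  be moved between different sections of \<open>G\<close> by computing in \<open>G\<close>.\<close>

definition cyclic_mod :: "('a, 'b) monoid_scheme \<Rightarrow> 'a set \<Rightarrow> 'a set \<Rightarrow> bool" where
  "cyclic_mod G H K \<longleftrightarrow> (\<exists>a\<in>H. \<forall>x\<in>H. \<exists>i::int. x \<otimes>\<^bsub>G\<^esub> inv\<^bsub>G\<^esub> (a [^]\<^bsub>G\<^esub> i) \<in> K)"

lemma (in group) rcos_eq_iff:
  assumes K: "subgroup K G" and x: "x \<in> carrier G" and y: "y \<in> carrier G"
  shows "K #> x = K #> y \<longleftrightarrow> x \<otimes> inv y \<in> K"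
proof
  assume "K #> x = K #> y"
  then have "x \<in> K #> y" using rcos_self[OF x K] by simp
  then show "x \<otimes> inv y \<in> K" using subgroup.rcos_module_imp[OF K is_group y] by blast
next
  assume "x \<otimes> inv y \<in> K"
  then have "x \<in> K #> y" using subgroup.rcos_module_rev[OF K is_group y x] by blast
  then show "K #> x = K #> y" using repr_independence[OF _ y K] by simp
qed

lemma (in group) cyclic_group_FactGroup_iff:
  assumes K: "K \<lhd> G" and H: "subgroup H G" and KH: "K \<subseteq> H"
  shows "cyclic_group (G\<lparr>carrier := H\<rparr> Mod K) \<longleftrightarrow> cyclic_mod G H K"
proof -
  let ?H = "G\<lparr>carrier := H\<rparr>"
  have KsG: "subgroup K G" using K normal_imp_subgroup by blast
  interpret K: normal K ?H using normal_restrict_supergroup[OF H K KH] .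
  interpret Q: group "?H Mod K" by (rule K.factorgroup_is_group)
  have HG: "x \<in> carrier G" if "x \<in> H" for x using that H subgroup.mem_carrier by metis
  have pow: "(K #> a) [^]\<^bsub>?H Mod K\<^esub> i = K #> (a [^] i)" if "a \<in> H" for a and i :: int
    using K.FactGroup_int_pow[of a i] that int_pow_consistent[OF H that] by simp
  have powH: "a [^] i \<in> H" if "a \<in> H" for a and i :: int
    using that H by (rule subgroup_int_pow_closed[rotated])
  have carr: "carrier (?H Mod K) = (\<lambda>x. K #> x) ` H" by (simp add: carrier_FactGroup)
  have "cyclic_group (?H Mod K) \<longleftrightarrow>
      (\<exists>a\<in>H. (\<lambda>x. K #> x) ` H = range (\<lambda>i::int. K #> (a [^] i)))"
    unfolding Q.cyclic_group carr by (auto simp: pow)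
  also have "\<dots> \<longleftrightarrow> (\<exists>a\<in>H. \<forall>x\<in>H. \<exists>i::int. K #> x = K #> (a [^] i))"
    using powH by (intro bex_cong refl) (auto simp: image_iff, blast+)
  also have "\<dots> \<longleftrightarrow> cyclic_mod G H K"
    unfolding cyclic_mod_def using HG by (intro bex_cong ball_cong ex_cong1 refl) (simp add: rcos_eq_iff[OF KsG])
  finally show ?thesis .
qed

section \<open>Chief factors below a product of two normal subgroups\<close>

lemma chief_factorD:
  assumes "chief_factor G H K"
  shows "H \<lhd> G" "K \<lhd> G" "K \<subset> H" "\<And>L. \<lbrakk>L \<lhd> G; K \<subseteq> L; L \<subseteq> H\<rbrakk> \<Longrightarrow> L = K \<or> L = H"
  using assms by (auto simp: chief_factor_def)

lemma (in group) cyclic_group_chief_factor_iff: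
  assumes "chief_factor G H K"
  shows "cyclic_group (G\<lparr>carrier := H\<rparr> Mod K) \<longleftrightarrow> cyclic_mod G H K"
  using cyclic_group_FactGroup_iff chief_factorD[OF assms] normal_imp_subgroup by blast

text \<open>The property whose greatest normal instance is the supersolvable hypercenter.\<close>

definition hypercentral :: "('a, 'b) monoid_scheme \<Rightarrow> 'a set \<Rightarrow> bool" where
  "hypercentral G N \<longleftrightarrow> (\<forall>H K. chief_factor G H K \<and> H \<subseteq> N \<longrightarrow> cyclic_mod G H K)"

text \<open>As \<open>H/K\<close> is chief, every normal \<open>L\<close> inside \<open>H\<close>
  satisfies \<open>KL = K\<close> or \<open>KL = H\<close>. For \<open>L = H \<inter> A\<close> the
  first is excluded; for \<open>L\<close> between the two intersections the alternative decides
  which of them \<open>L\<close> is.\<close>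

lemma (in group) chief_factor_Int_left:
  assumes chief: "chief_factor G H K" and A: "A \<lhd> G" and ne: "\<not> H \<inter> A \<subseteq> K"
  shows "chief_factor G (H \<inter> A) (K \<inter> A)" "H \<subseteq> K <#> (H \<inter> A)"
proof -
  note c = chief_factorD[OF chief]
  have HA: "H \<inter> A \<lhd> G" "K \<inter> A \<lhd> G" using c A normal_subgroup_intersect by blast+
  have sub: "subgroup H G" "subgroup K G" "subgroup A G" using c A normal_imp_subgroup by blast+
  have *: "K <#> L = K \<or> K <#> L = H" if "L \<lhd> G" "L \<subseteq> H" for L
  proof (rule c(4))
    show "K <#> L \<lhd> G" by (rule normal_subgroup_set_mult_closed[OF c(2) that(1)])
    show "K \<subseteq> K <#> L" using subset_set_mult(1)[OF sub(2) normal_imp_subgroup[OF that(1)]] .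
    show "K <#> L \<subseteq> H" using set_mult_subset_subgroup[OF sub(1)] c that by blast
  qed
  have sup: "L \<subseteq> K <#> L" if "L \<lhd> G" for L
    using subset_set_mult(2)[OF sub(2) normal_imp_subgroup[OF that]] .
  show "H \<subseteq> K <#> (H \<inter> A)" using *[OF HA(1)] sup[OF HA(1)] ne by blast
  show "chief_factor G (H \<inter> A) (K \<inter> A)"
    unfolding chief_factor_def
  proof (intro conjI allI impI HA)
    show "K \<inter> A \<subset> H \<inter> A" using c ne by blast
    fix L assume L: "L \<lhd> G" "K \<inter> A \<subseteq> L" "L \<subseteq> H \<inter> A"
    then consider "K <#> L = K" | "K <#> L = H" using * by blast
    then show "L = K \<inter> A \<or> L = H \<inter> A"
    proof cases
      case 1
      then show ?thesis using sup[OF L(1)] L by blast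
    next
      case 2
      \<comment> \<open>Dedekind's law: in \<open>x = k \<otimes> l\<close> both \<open>x\<close>
        and \<open>l\<close> lie in \<open>A\<close>, so \<open>k\<close> lies in
        \<open>K \<inter> A\<close>, which is below \<open>L\<close>.\<close>
      have "H \<inter> A \<subseteq> L"
      proof
        fix x assume x: "x \<in> H \<inter> A"
        then obtain k l where kl: "k \<in> K" "l \<in> L" "x = k \<otimes> l" using 2 by (auto simp: set_mult_def)
        have G: "k \<in> carrier G" "l \<in> carrier G" using subgroup.mem_carrier[OF sub(2) kl(1)] normal_subset[OF L(1)] kl by auto
        then have "k = x \<otimes> inv l" using kl by (simp add: m_assoc)
        moreover have "l \<in> A" using kl L by blast
        ultimately have "k \<in> A" using x sub(3) by (simp add: subgroup.m_closed subgroup.m_inv_closed)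
        then have "k \<in> L" using kl L by blast
        then show "x \<in> L" using kl normal_imp_subgroup[OF L(1)] by (simp add: subgroup.m_closed)
      qed
      then show ?thesis using L by blast
    qed
  qed
qed

text \<open>A generator of \<open>H \<inter> A\<close> modulo \<open>K \<inter> A\<close> also
  generates \<open>H\<close> modulo \<open>K\<close>, because elements of \<open>H\<close> and of
  \<open>H \<inter> A\<close> agree up to factors from \<open>K\<close>.\<close>

lemma (in group) cyclic_mod_of_Int:
  assumes K: "subgroup K G" and H: "subgroup H G" and le: "H \<subseteq> K <#> (H \<inter> A)" and cyc: "cyclic_mod G (H \<inter> A) (K \<inter> A)"
  shows "cyclic_mod G H K"
proof -
  obtain a where a: "a \<in> H \<inter> A" and gen: "\<And>x. x \<in> H \<inter> A \<Longrightarrow> \<exists>i::int. x \<otimes> inv (a [^] i) \<in> K \<inter> A"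
    using cyc by (auto simp: cyclic_mod_def)
  have aG: "a \<in> carrier G" using a subgroup.mem_carrier[OF H] by blast
  have "\<exists>i::int. x \<otimes> inv (a [^] i) \<in> K" if x: "x \<in> H" for x
  proof -
    have "x \<in> K <#> (H \<inter> A)" using le x by blast
    then obtain k y where ky: "k \<in> K" "y \<in> H \<inter> A" "x = k \<otimes> y" by (auto simp: set_mult_def)
    obtain i :: int where i: "y \<otimes> inv (a [^] i) \<in> K" using gen[OF ky(2)] by blast
    have "k \<in> carrier G" "y \<in> carrier G" using ky subgroup.mem_carrier[OF H] subgroup.mem_carrier[OF K] by auto
    then have "x \<otimes> inv (a [^] i) = k \<otimes> (y \<otimes> inv (a [^] i))" using ky aG by (simp add: m_assoc)
    then show ?thesis using subgroup.m_closed[OF K ky(1) i] by (intro exI[of _ i]) simp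
  qed
  then show ?thesis using a by (auto simp: cyclic_mod_def)
qed

text \<open>This form lets elements of \<open>A\<close> translate elements between \<open>H\<close>
  and \<open>B\<close> in \<open>chief_factor_Int_right\<close> and
  \<open>cyclic_mod_of_set_mult\<close>.\<close>

lemma (in group) mem_set_mult_iff:
  assumes A: "subgroup A G" and H: "subgroup H G" and x: "x \<in> carrier G"
  shows "x \<in> A <#> H \<longleftrightarrow> (\<exists>a\<in>A. a \<otimes> x \<in> H)"
proof
  assume "x \<in> A <#> H"
  then obtain a h where ah: "a \<in> A" "h \<in> H" "x = a \<otimes> h" by (auto simp: set_mult_def)
  then have "a \<in> carrier G" "h \<in> carrier G" using subgroup.mem_carrier A H by metis+
  then have "inv a \<otimes> x = h" using ah by (simp flip: m_assoc)
  then show "\<exists>a\<in>A. a \<otimes> x \<in> H" using ah subgroup.m_inv_closed[OF A] by metis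
next
  assume "\<exists>a\<in>A. a \<otimes> x \<in> H"
  then obtain a where a: "a \<in> A" "a \<otimes> x \<in> H" by blast
  then have "x = inv a \<otimes> (a \<otimes> x)" using subgroup.mem_carrier[OF A] x by (simp flip: m_assoc)
  then show "x \<in> A <#> H" using a subgroup.m_inv_closed[OF A] by (force simp: set_mult_def)
qed

text \<open>The case complementary to \<open>chief_factor_Int_left\<close>. Since
  \<open>H \<inter> A\<close> lies in \<open>K\<close>, \<open>H/K\<close> is isomorphic to
  \<open>AH/AK\<close>, and since \<open>H\<close> lies in \<open>AB\<close>, the latter is
  isomorphic to \<open>(AH \<inter> B)/(AK \<inter> B)\<close>. The proof follows these isomorphisms
  on elements: left multiplication by elements of \<open>A\<close> leads from \<open>H\<close> into
  \<open>B\<close> and back.\<close>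

lemma (in group) chief_factor_Int_right:
  assumes chief: "chief_factor G H K" and A: "A \<lhd> G" and B: "B \<lhd> G"
    and HAB: "H \<subseteq> A <#> B" and le: "H \<inter> A \<subseteq> K"
  shows "chief_factor G ((A <#> H) \<inter> B) ((A <#> K) \<inter> B)"
proof -
  note c = chief_factorD[OF chief]
  have sub: "subgroup H G" "subgroup K G" "subgroup A G" "subgroup B G"
    using c A B normal_imp_subgroup by blast+
  have carr: "\<And>x. x \<in> H \<Longrightarrow> x \<in> carrier G" "\<And>x. x \<in> A \<Longrightarrow> x \<in> carrier G" "\<And>x. x \<in> B \<Longrightarrow> x \<in> carrier G"
    using sub subgroup.mem_carrier by metis+
  let ?HB = "(A <#> H) \<inter> B" and ?KB = "(A <#> K) \<inter> B"
  have norm: "?HB \<lhd> G" "?KB \<lhd> G"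
    by (rule normal_subgroup_intersect[OF normal_subgroup_set_mult_closed[OF A] B], rule c)+
  have mono: "?KB \<subseteq> ?HB" using c by (auto simp: set_mult_def)
  have ABK: "A \<inter> B \<subseteq> ?KB" using subset_set_mult[OF sub(3,2)] by blast
  \<comment> \<open>Every \<open>x\<close> in \<open>H\<close> can be translated into
    \<open>B\<close> by an element of \<open>A\<close>, because \<open>H\<close> lies in
    \<open>AB\<close>.\<close>
  have key: "M \<inter> B \<subseteq> N \<inter> B \<Longrightarrow> \<exists>a\<in>A. a \<otimes> x \<in> N \<inter> B" if x: "x \<in> H" and M: "A <#> H \<subseteq> M" for x M N
  proof -
    assume sub: "M \<inter> B \<subseteq> N \<inter> B"
    have "x \<in> A <#> B" using HAB x by blast
    then obtain a where a: "a \<in> A" "a \<otimes> x \<in> B"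
      using mem_set_mult_iff[OF \<open>subgroup A G\<close> \<open>subgroup B G\<close>] carr x by blast
    then have "a \<otimes> x \<in> M" using M x by (auto simp: set_mult_def)
    then show ?thesis using a sub by blast
  qed
  show ?thesis
    unfolding chief_factor_def
  proof (intro conjI allI impI norm)
    have "?KB \<noteq> ?HB"
    proof
      assume eq: "?KB = ?HB"
      have "H \<subseteq> K"
      proof
        fix h assume h: "h \<in> H"
        then obtain a where a: "a \<in> A" "a \<otimes> h \<in> A <#> K" using key[OF h order_refl, of "A <#> K"] eq by auto
        then obtain a' k where k: "a' \<in> A" "k \<in> K" "a \<otimes> h = a' \<otimes> k" by (auto simp: set_mult_def)
        have kH: "k \<in> H" using k c by blast
        have "h \<otimes> inv k = inv a \<otimes> (a \<otimes> h) \<otimes> inv k" using a h kH carr by (simp flip: m_assoc)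
        also have "\<dots> = inv a \<otimes> a'" using k kH a carr by (simp add: m_assoc)
        finally have "h \<otimes> inv k \<in> A" using k a sub by (simp add: subgroup.m_closed subgroup.m_inv_closed)
        moreover have "h \<otimes> inv k \<in> H" using h kH sub by (simp add: subgroup.m_closed subgroup.m_inv_closed)
        ultimately have "h \<otimes> inv k \<in> K" using le by blast
        then have "h \<otimes> inv k \<otimes> k \<in> K" using k sub by (simp add: subgroup.m_closed)
        then show "h \<in> K" using h kH carr by (simp add: m_assoc)
      qed
      then show False using c by blast
    qed
    then show "?KB \<subset> ?HB" using mono by blast
    fix L assume L: "L \<lhd> G" "?KB \<subseteq> L" "L \<subseteq> ?HB"
    have sL: "subgroup L G" using L normal_imp_subgroup by blast
    \<comment> \<open>\<open>?M\<close> is the normal subgroup between \<open>K\<close> and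
      \<open>H\<close> that corresponds to \<open>L\<close>; the chief factor \<open>H/K\<close>
      forces it to be one of the two.\<close>
    let ?M = "(A <#> L) \<inter> H"
    have Mn: "?M \<lhd> G" by (rule normal_subgroup_intersect[OF normal_subgroup_set_mult_closed[OF A L(1)] c(1)])
    have "K \<subseteq> ?M"
    proof
      fix k assume k: "k \<in> K"
      then have kH: "k \<in> H" using c by blast
      then have "k \<in> A <#> B" using HAB by blast
      then obtain a where a: "a \<in> A" "a \<otimes> k \<in> B" using mem_set_mult_iff[OF sub(3,4)] carr kH by blast
      then have "a \<otimes> k \<in> ?KB" using k by (auto simp: set_mult_def)
      then have "k \<in> A <#> L" using mem_set_mult_iff[OF sub(3) sL] a L kH carr by blast
      then show "k \<in> ?M" using kH by blast
    qed
    then consider "?M = K" | "?M = H" using c(4)[OF Mn] by blast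
    then show "L = ?KB \<or> L = ?HB"
    proof cases
      case 1
      have "L \<subseteq> ?KB"
      proof
        fix x assume x: "x \<in> L"
        then have xH: "x \<in> A <#> H" "x \<in> B" using L by blast+
        then obtain a where a: "a \<in> A" "a \<otimes> x \<in> H" using mem_set_mult_iff[OF sub(3,1)] carr by blast
        then have "a \<otimes> x \<in> ?M" using x by (auto simp: set_mult_def)
        then have "x \<in> A <#> K" using 1 a mem_set_mult_iff[OF sub(3,2)] carr xH by blast
        then show "x \<in> ?KB" using xH by blast
      qed
      then show ?thesis using L by blast
    next
      case 2
      have "?HB \<subseteq> L"
      proof
        fix x assume x: "x \<in> ?HB"
        then have xG: "x \<in> carrier G" using carr by blast
        obtain a where a: "a \<in> A" "a \<otimes> x \<in> H" using x xG mem_set_mult_iff[OF sub(3,1)] by blast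
        then have "a \<otimes> x \<in> A <#> L" using 2 by blast
        then obtain a' where a': "a' \<in> A" "a' \<otimes> (a \<otimes> x) \<in> L"
          using mem_set_mult_iff[OF sub(3) sL, of "a \<otimes> x"] a carr by blast
        \<comment> \<open>\<open>l\<close> and \<open>x\<close> differ by the factor
          \<open>a' \<otimes> a\<close>, which lies in \<open>A \<inter> B\<close> and so, by
          \<open>ABK\<close>, in \<open>L\<close>.\<close>
        define l where "l = a' \<otimes> (a \<otimes> x)"
        have l: "l \<in> L" "l \<in> B" "l \<in> carrier G" using a' L carr by (auto simp: l_def)
        have "l \<otimes> inv x = a' \<otimes> a" using a a' xG carr by (simp add: l_def m_assoc)
        moreover have "l \<otimes> inv x \<in> B" using l x sub by (simp add: subgroup.m_closed subgroup.m_inv_closed)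
        moreover have "a' \<otimes> a \<in> A" using a a' sub by (simp add: subgroup.m_closed)
        ultimately have "l \<otimes> inv x \<in> L" using ABK L by auto
        then have "inv (l \<otimes> inv x) \<otimes> l \<in> L" using l sL by (simp add: subgroup.m_closed subgroup.m_inv_closed)
        then show "x \<in> L" using l xG by (simp add: inv_mult_group m_assoc)
      qed
      then show ?thesis using L by blast
    qed
  qed
qed

text \<open>The generator \<open>c\<close> of the section in \<open>B\<close> is translated by an
  element of \<open>A\<close> to some \<open>h\<close> in \<open>H\<close>. Then \<open>c\<close>
  and \<open>h\<close> have the same powers modulo \<open>A\<close>, and
  \<open>AK \<inter> H = K\<close> brings congruences modulo \<open>AK\<close> back to
  \<open>K\<close>.\<close>

lemma (in group) cyclic_mod_of_set_mult:
  assumes H: "subgroup H G" and K: "K \<lhd> G" "K \<subseteq> H" and A: "A \<lhd> G" and B: "subgroup B G"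
    and HAB: "H \<subseteq> A <#> B" and le: "H \<inter> A \<subseteq> K"
    and cyc: "cyclic_mod G ((A <#> H) \<inter> B) ((A <#> K) \<inter> B)"
  shows "cyclic_mod G H K"
proof -
  interpret A: normal A G by (rule A)
  have sub: "subgroup K G" "subgroup A G" "subgroup (A <#> K) G"
    by (rule normal_imp_subgroup, rule K A normal_subgroup_set_mult_closed[OF A K(1)])+
  have carr: "\<And>x. x \<in> H \<Longrightarrow> x \<in> carrier G" "\<And>x. x \<in> A \<Longrightarrow> x \<in> carrier G" "\<And>x. x \<in> B \<Longrightarrow> x \<in> carrier G"
    using H sub B subgroup.mem_carrier by metis+
  obtain c where c: "c \<in> A <#> H" "c \<in> B"
    and gen: "\<And>x. x \<in> (A <#> H) \<inter> B \<Longrightarrow> \<exists>i::int. x \<otimes> inv (c [^] i) \<in> (A <#> K) \<inter> B"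
    using cyc by (auto simp: cyclic_mod_def)
  obtain a0 where a0: "a0 \<in> A" "a0 \<otimes> c \<in> H" using c mem_set_mult_iff[OF sub(2) H] carr by blast
  define h where "h = a0 \<otimes> c"
  have h: "h \<in> H" "h \<in> carrier G" using a0 carr by (auto simp: h_def)
  have cG: "c \<in> carrier G" using c carr by blast
  have "h \<otimes> inv c \<in> A" using a0 cG carr by (simp add: h_def m_assoc)
  then have "A #> h = A #> c" using h cG by (simp add: rcos_eq_iff[OF sub(2)])
  then have "A #> (h [^] i) = A #> (c [^] i)" for i :: int
    using A.FactGroup_int_pow[of h i] A.FactGroup_int_pow[of c i] h cG by simp
  then have hc: "c [^] i \<otimes> inv (h [^] i) \<in> A" for i :: int
    using h cG rcos_eq_iff[OF sub(2), of "c [^] i" "h [^] i"] by auto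
  have AleAK: "A \<subseteq> A <#> K" using subset_set_mult sub by blast
  have AKH: "y \<in> K" if y: "y \<in> A <#> K" "y \<in> H" for y
  proof -
    obtain a where a: "a \<in> A" "a \<otimes> y \<in> K" using y mem_set_mult_iff[OF sub(2,1)] carr by blast
    have "a = (a \<otimes> y) \<otimes> inv y" using a y carr by (simp add: m_assoc)
    also have "\<dots> \<in> H" using a y K H by (auto simp: subgroup.m_closed subgroup.m_inv_closed)
    finally have "a \<in> K" using a le by blast
    then have "inv a \<otimes> (a \<otimes> y) \<in> K" using a sub by (simp add: subgroup.m_closed subgroup.m_inv_closed)
    then show ?thesis using a y carr by (simp flip: m_assoc)
  qed
  have "\<exists>i::int. x \<otimes> inv (h [^] i) \<in> K" if x: "x \<in> H" for x
  proof -
    have "x \<in> A <#> B" using x HAB by blast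
    then obtain a where a: "a \<in> A" "a \<otimes> x \<in> B" using mem_set_mult_iff[OF sub(2) B] carr x by blast
    have "a \<otimes> x \<in> A <#> H" using a x by (auto simp: set_mult_def)
    then obtain i :: int where i: "a \<otimes> x \<otimes> inv (c [^] i) \<in> A <#> K" using gen a by blast
    \<comment> \<open>The factors \<open>inv a\<close> and \<open>?d\<close> come from
      \<open>A\<close>; they undo the translation of \<open>x\<close> and replace the power of
      \<open>c\<close> by that of \<open>h\<close>.\<close>
    let ?d = "c [^] i \<otimes> inv (h [^] i)"
    have "inv a \<in> A <#> K" "?d \<in> A <#> K" using a AleAK hc[of i] subgroup.m_inv_closed[OF sub(2)] by blast+
    then have "inv a \<otimes> (a \<otimes> x \<otimes> inv (c [^] i)) \<otimes> ?d \<in> A <#> K"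
      using i by (simp add: subgroup.m_closed[OF sub(3)])
    also have "inv a \<otimes> (a \<otimes> x \<otimes> inv (c [^] i)) \<otimes> ?d = inv a \<otimes> (a \<otimes> x) \<otimes> inv (h [^] i)"
      using a x h cG carr by (simp add: m_assoc) (simp flip: m_assoc)
    also have "\<dots> = x \<otimes> inv (h [^] i)" using a x h carr by (simp flip: m_assoc)
    finally have "x \<otimes> inv (h [^] i) \<in> A <#> K" .
    moreover have "x \<otimes> inv (h [^] i) \<in> H"
      using x h(1) subgroup_int_pow_closed[OF H h(1)] H by (simp add: subgroup.m_closed subgroup.m_inv_closed)
    ultimately show ?thesis using AKH by blast
  qed
  then show ?thesis using h by (auto simp: cyclic_mod_def)
qed

text \<open>A chief factor \<open>H/K\<close> below \<open>AB\<close> is isomorphic to one below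
  \<open>A\<close> if \<open>H \<inter> A\<close> is not contained in \<open>K\<close>, and to one
  below \<open>B\<close> otherwise.\<close>

lemma (in group) hypercentral_set_mult:
  assumes A: "A \<lhd> G" "hypercentral G A" and B: "B \<lhd> G" "hypercentral G B"
  shows "hypercentral G (A <#> B)"
  unfolding hypercentral_def
proof (intro allI impI)
  fix H K assume HK: "chief_factor G H K \<and> H \<subseteq> A <#> B"
  note c = chief_factorD[OF HK[THEN conjunct1]]
  have sub: "subgroup H G" "subgroup K G" "subgroup B G" using c B normal_imp_subgroup by blast+
  show "cyclic_mod G H K"
  proof (cases "H \<inter> A \<subseteq> K")
    case True
    have "chief_factor G ((A <#> H) \<inter> B) ((A <#> K) \<inter> B)"
      using chief_factor_Int_right HK A B True by blast
    then have "cyclic_mod G ((A <#> H) \<inter> B) ((A <#> K) \<inter> B)" using B(2) by (auto simp: hypercentral_def)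
    then show ?thesis using cyclic_mod_of_set_mult[OF sub(1) c(2) _ A(1) sub(3) _ True] HK c(3) by blast
  next
    case False
    from chief_factor_Int_left[OF HK[THEN conjunct1] A(1) False]
    have "cyclic_mod G (H \<inter> A) (K \<inter> A)" "H \<subseteq> K <#> (H \<inter> A)" using A(2) by (auto simp: hypercentral_def)
    then show ?thesis using cyclic_mod_of_Int sub by blast
  qed
qed

theorem (in fin_group) hypercentral_supersolvable_hypercenter:
  "hypercentral G (supersolvable_hypercenter G)"
proof -
  have eq: "hypercentral G N \<longleftrightarrow>
    (\<forall>H K. chief_factor G H K \<and> H \<subseteq> N \<longrightarrow> cyclic_group (G\<lparr>carrier := H\<rparr> Mod K))" for N
    unfolding hypercentral_def using cyclic_group_chief_factor_iff by blast
  have "hypercentral G {\<one>}"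
    unfolding hypercentral_def
  proof (intro allI impI)
    fix H K assume "chief_factor G H K \<and> H \<subseteq> {\<one>}"
    then have "K \<subset> {\<one>}" "subgroup K G" by (auto dest: chief_factorD normal_imp_subgroup)
    then have False using subgroup.one_closed[of K G] by blast
    then show "cyclic_mod G H K" ..
  qed
  from Greatest_normal(2)[of "hypercentral G", OF this hypercentral_set_mult]
  show ?thesis unfolding supersolvable_hypercenter_def eq by blast
qed

text \<open>\<open>A\<close> is maximal among the normal subgroups of \<open>G\<close> properly
  inside \<open>L\<close>; this drives the inductions along a chief series.\<close>

lemma (in fin_group) chief_factor_below:
  assumes L: "L \<lhd> G" and ne: "L \<noteq> {\<one>}"
  obtains A where "chief_factor G L A"
proof -
  let ?X = "{A. A \<lhd> G \<and> A \<subset> L}"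
  have "finite ?X" using normal_subset[OF L] by (intro finite_subset[of ?X "Pow (carrier G)"]) auto
  moreover have "{\<one>} \<in> ?X" using one_is_normal ne subgroup.one_closed[OF normal_imp_subgroup[OF L]] by auto
  ultimately obtain A where A: "A \<in> ?X" "\<And>B. B \<in> ?X \<Longrightarrow> A \<subseteq> B \<Longrightarrow> A = B"
    using finite_has_maximal[of ?X] by (metis (no_types, lifting) empty_iff)
  then have "chief_factor G L A" using L by (auto simp: chief_factor_def)
  then show thesis using that by blast
qed

subsection \<open>The action on chief factors\<close>

lemma (in group) subgroup_nat_pow_closed:
  "\<lbrakk>subgroup H G; x \<in> H\<rbrakk> \<Longrightarrow> x [^] (n::nat) \<in> H"
  using subgroup_int_pow_closed[of H x "int n"] by (simp add: int_pow_int)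

lemma (in fin_group) pow_card_subgroup:
  assumes H: "subgroup H G" and x: "x \<in> H" shows "x [^] card H = \<one>"
proof -
  interpret H: fin_group "G\<lparr>carrier := H\<rparr>" using H fin_group_subgroup by blast
  have "x [^]\<^bsub>G\<lparr>carrier := H\<rparr>\<^esub> order (G\<lparr>carrier := H\<rparr>) = \<one>\<^bsub>G\<lparr>carrier := H\<rparr>\<^esub>"
    using H.pow_order_eq_1[of x] x by simp
  then show ?thesis by (simp add: order_def nat_pow_consistent[of x "card H" H])
qed

text \<open>Induction on \<open>e\<close> from the case \<open>v ^ p\<close>, which is Fermat's
  little theorem, or trivial when \<open>p\<close> divides \<open>v\<close>.\<close>

lemma power_prime_power_mod:
  fixes p u :: nat
  assumes p: "Factorial_Ring.prime p"
  shows "u ^ p ^ e mod p = u mod p"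
proof (induction e)
  case (Suc e)
  have *: "v ^ p mod p = v mod p" for v :: nat
  proof (cases "p dvd v")
    case True
    moreover have "v dvd v ^ p" using prime_gt_0_nat[OF p] by (simp add: dvd_power)
    ultimately have "p dvd v ^ p" using dvd_trans by blast
    then show ?thesis using True by simp
  next
    case False
    then have "[v ^ (p - 1) = 1] (mod p)" using fermat_theorem[OF p] by blast
    then have "[v ^ (p - 1) * v = 1 * v] (mod p)" by (rule cong_scalar_right)
    moreover have "v ^ (p - 1) * v = v ^ p" using prime_gt_0_nat[OF p] by (simp add: power_eq_if mult.commute)
    ultimately show ?thesis by (simp add: cong_def)
  qed
  have "u ^ p ^ Suc e = (u ^ p ^ e) ^ p" by (simp add: power_mult[symmetric] mult.commute)
  then show ?case using *[of "u ^ p ^ e"] Suc by simp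
qed simp

lemma (in group) nat_pow_mod:
  assumes "x \<in> carrier G" "x [^] (p::nat) = \<one>"
  shows "x [^] (m mod p) = x [^] m"
proof -
  have "x [^] m = x [^] (p * (m div p) + m mod p)" by simp
  also have "\<dots> = (x [^] p) [^] (m div p) \<otimes> x [^] (m mod p)"
    using assms(1) by (simp only: nat_pow_mult[symmetric] nat_pow_pow)
  finally show ?thesis using assms by simp
qed

text \<open>Conjugating \<open>a\<close> by \<open>t ^ (p ^ e)\<close> raises it to the power \<open>u ^ (p ^ e)\<close>, which is \<open>u\<close> modulo \<open>p\<close>
  by Fermat's little theorem.\<close>

lemma (in group) conjg_eq_self_of_prime_order:
  fixes p u :: nat
  assumes p: "Factorial_Ring.prime p" and t: "t \<in> carrier G" "t [^] (p ^ e) = \<one>"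
    and a: "a \<in> carrier G" "a [^] p = \<one>" and u: "conjg G t a = a [^] u"
  shows "conjg G t a = a"
proof -
  have "conjg G (t [^] n) a = a [^] (u ^ n)" for n :: nat
  proof (induction n)
    case (Suc n)
    have "conjg G (t [^] Suc n) a = conjg G t (a [^] (u ^ n))"
      using Suc t a by (simp flip: conjg_conjg)
    also have "\<dots> = (a [^] u) [^] (u ^ n)" using t a u by (simp add: conjg_nat_pow)
    finally show ?case using a by (simp add: nat_pow_pow)
  qed (use a in simp)
  from this[of "p ^ e"] have "a = a [^] (u ^ p ^ e)" using t a by simp
  also have "\<dots> = a [^] (u ^ p ^ e mod p)" using nat_pow_mod a by metis
  also have "\<dots> = a [^] u" using nat_pow_mod[OF a] power_prime_power_mod[OF p] by simp
  finally show ?thesis using u by simp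
qed

lemma (in group) cyclic_modD:
  assumes A: "A \<lhd> G" and H: "H \<subseteq> carrier G" and cyc: "cyclic_mod G H A"
  shows "\<exists>a\<in>H. \<forall>x\<in>H. \<exists>i::int. A #> x = (A #> a) [^]\<^bsub>G Mod A\<^esub> i"
proof -
  interpret A: normal A G by (rule A)
  obtain a where a: "a \<in> H" "\<And>x. x \<in> H \<Longrightarrow> \<exists>i::int. x \<otimes> inv (a [^] i) \<in> A"
    using cyc by (auto simp: cyclic_mod_def)
  have aG: "a \<in> carrier G" using a H by blast
  have "\<exists>i::int. A #> x = (A #> a) [^]\<^bsub>G Mod A\<^esub> i" if x: "x \<in> H" for x
  proof -
    obtain i :: int where "x \<otimes> inv (a [^] i) \<in> A" using a x by blast
    moreover have "x \<in> carrier G" using x H by blast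
    ultimately have "A #> x = A #> (a [^] i)" using rcos_eq_iff[OF A.subgroup_axioms] aG by simp
    then show ?thesis using A.FactGroup_int_pow[OF aG] by metis
  qed
  with a show ?thesis by blast
qed

lemma (in normal) FactGroup_closed: "x \<in> carrier G \<Longrightarrow> H #> x \<in> carrier (G Mod H)"
  by (simp add: carrier_FactGroup)

lemma (in normal) FactGroup_conjg:
  assumes "g \<in> carrier G" "x \<in> carrier G"
  shows "conjg (G Mod H) (H #> g) (H #> x) = H #> conjg G g x"
  using assms by (simp add: conjg_def inv_FactGroup FactGroup_closed rcos_inv rcos_sum)

lemma (in normal) rcos_eq_self_iff: "x \<in> carrier G \<Longrightarrow> H #> x = H \<longleftrightarrow> x \<in> H"
  using coset_join1 coset_join2 subgroup_axioms subset by blast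

text \<open>\<open>H/A\<close> is abelian, so the elements of \<open>H\<close> whose
  \<open>p\<close>-th power lies in \<open>A\<close> form a subgroup \<open>L\<close>, normal in
  \<open>G\<close>. It is larger than \<open>A\<close> because \<open>H\<close> is a
  \<open>p\<close>-group; the chief factor leaves only \<open>L = H\<close>.\<close>

lemma (in fin_group) chief_factor_exponent:
  fixes p :: nat
  assumes p: "Factorial_Ring.prime p" and chief: "chief_factor G H A" and cyc: "cyclic_mod G H A"
    and cH: "card H = p ^ r" and x: "x \<in> H"
  shows "x [^] p \<in> A"
proof -
  note c = chief_factorD[OF chief]
  have sub: "subgroup H G" "subgroup A G" using c normal_imp_subgroup by blast+
  interpret A: normal A G by (rule c(2))
  interpret Q: group "G Mod A" by (rule A.factorgroup_is_group)
  have HG: "H \<subseteq> carrier G" using normal_subset c by blast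
  obtain a where a: "a \<in> H" "\<And>x. x \<in> H \<Longrightarrow> \<exists>i::int. A #> x = (A #> a) [^]\<^bsub>G Mod A\<^esub> i"
    using cyclic_modD[OF c(2) HG cyc] by blast
  have aQ: "A #> a \<in> carrier (G Mod A)" using a HG A.FactGroup_closed by blast
  have comm: "(A #> x) \<otimes>\<^bsub>G Mod A\<^esub> (A #> y) = (A #> y) \<otimes>\<^bsub>G Mod A\<^esub> (A #> x)" if xy: "x \<in> H" "y \<in> H" for x y
  proof -
    obtain i j :: int where ij: "A #> x = (A #> a) [^]\<^bsub>G Mod A\<^esub> i" "A #> y = (A #> a) [^]\<^bsub>G Mod A\<^esub> j"
      using a(2)[OF xy(1)] a(2)[OF xy(2)] by blast
    show ?thesis unfolding ij using Q.int_pow_mult[OF aQ, of i j] Q.int_pow_mult[OF aQ, of j i] by (metis add.commute)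
  qed
  define L where "L = {x \<in> H. x [^] p \<in> A}"
  have AL: "A \<subseteq> L" using c(3) sub(2) by (auto simp: L_def subgroup_nat_pow_closed)
  have Lpow: "x \<in> L \<longleftrightarrow> x \<in> H \<and> (A #> x) [^]\<^bsub>G Mod A\<^esub> p = \<one>\<^bsub>G Mod A\<^esub>" for x
    using A.FactGroup_pow[of x p] A.rcos_eq_self_iff[of "x [^] p"] HG by (auto simp: L_def)
  have "subgroup L G"
  proof (rule subgroupI)
    show "L \<subseteq> carrier G" using HG by (auto simp: L_def)
    show "L \<noteq> {}" using AL sub subgroup.one_closed by blast
  next
    fix x assume x: "x \<in> L"
    then have "x \<in> carrier G" using HG by (auto simp: L_def)
    then show "inv x \<in> L" using x sub by (auto simp: L_def subgroup.m_inv_closed nat_pow_inv)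
  next
    fix x y assume x: "x \<in> L" and y: "y \<in> L"
    then have xy: "x \<in> H" "y \<in> H" "x \<in> carrier G" "y \<in> carrier G" using HG by (auto simp: L_def)
    then have "(A #> (x \<otimes> y)) [^]\<^bsub>G Mod A\<^esub> p = ((A #> x) \<otimes>\<^bsub>G Mod A\<^esub> (A #> y)) [^]\<^bsub>G Mod A\<^esub> p"
      by (simp add: A.rcos_sum)
    also have "\<dots> = \<one>\<^bsub>G Mod A\<^esub>"
      using x y xy by (subst Q.pow_mult_distrib[OF comm]) (auto simp: Lpow A.FactGroup_closed simp del: mult_FactGroup one_FactGroup)
    finally show "x \<otimes> y \<in> L" using xy sub by (simp add: Lpow subgroup.m_closed)
  qed
  moreover have "conjg G g x \<in> L" if "g \<in> carrier G" "x \<in> L" for g x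
    using that c HG by (auto simp: L_def normal_conjg_iff simp flip: conjg_nat_pow)
  ultimately have Ln: "L \<lhd> G" by (simp add: normal_conjg_iff)
  have "L \<noteq> A"
  proof -
    obtain b where b: "b \<in> H" "b \<notin> A" using c by blast
    have bG: "b \<in> carrier G" using b HG by blast
    have ex: "b [^] (p ^ r) \<in> A" using pow_card_subgroup[OF sub(1) b(1)] cH sub(2) by (simp add: subgroup.one_closed)
    \<comment> \<open>With the least such \<open>j\<close>, the element
      \<open>b [^] (p ^ (j - 1))\<close> lies in \<open>L\<close> but not in
      \<open>A\<close>.\<close>
    define j where "j = (LEAST j. b [^] (p ^ j) \<in> A)"
    have j: "b [^] (p ^ j) \<in> A" unfolding j_def by (rule LeastI[of _ r]) (rule ex)
    have "j \<noteq> 0" using j b bG by (cases j) auto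
    then obtain i where i: "j = Suc i" by (cases j) auto
    have "b [^] (p ^ i) \<notin> A" using not_less_Least[of i "\<lambda>j. b [^] (p ^ j) \<in> A"] i by (simp add: j_def)
    moreover have "(b [^] (p ^ i)) [^] p \<in> A" using j bG by (simp add: i nat_pow_pow mult.commute)
    moreover have "b [^] (p ^ i) \<in> H" using b(1) sub(1) by (simp add: subgroup_nat_pow_closed)
    ultimately show ?thesis by (auto simp: L_def)
  qed
  then have "L = H" using c(4)[OF Ln AL] by (auto simp: L_def)
  then show ?thesis using x by (auto simp: L_def)
qed

definition chief_centralizer :: "('a, 'b) monoid_scheme \<Rightarrow> 'a set \<Rightarrow> 'a set" where
  "chief_centralizer G R = {g \<in> carrier G. \<forall>H A. chief_factor G H A \<and> H \<subseteq> R \<longrightarrow>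
     (\<forall>x\<in>H. A #>\<^bsub>G\<^esub> conjg G g x = A #>\<^bsub>G\<^esub> x)}"

lemma (in group) subgroup_chief_centralizer: "subgroup (chief_centralizer G R) G"
proof (rule subgroupI)
  show "chief_centralizer G R \<noteq> {}"
  proof -
    have "A #> conjg G \<one> x = A #> x" if "chief_factor G H A" "x \<in> H" for H A x
      using chief_factorD(1)[OF that(1)] that(2) normal_subset by fastforce
    then have "\<one> \<in> chief_centralizer G R" by (auto simp: chief_centralizer_def)
    then show ?thesis by blast
  qed
next
  fix g assume g: "g \<in> chief_centralizer G R"
  then have gG: "g \<in> carrier G" by (simp add: chief_centralizer_def)
  have "A #> conjg G (inv g) x = A #> x" if ch: "chief_factor G H A" "H \<subseteq> R" "x \<in> H" for H A x
  proof -
    have xG: "x \<in> carrier G" using ch chief_factorD(1) normal_subset by blast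
    have "conjg G (inv g) x \<in> H" using ch chief_factorD(1)[OF ch(1)] gG by (simp add: normal_conjg_iff)
    then have "A #> conjg G g (conjg G (inv g) x) = A #> conjg G (inv g) x"
      using g ch by (auto simp: chief_centralizer_def)
    then show ?thesis using xG gG by simp
  qed
  then show "inv g \<in> chief_centralizer G R" using gG by (auto simp: chief_centralizer_def)
next
  fix g h assume g: "g \<in> chief_centralizer G R" and h: "h \<in> chief_centralizer G R"
  then have G: "g \<in> carrier G" "h \<in> carrier G" by (auto simp: chief_centralizer_def)
  have "A #> conjg G (g \<otimes> h) x = A #> x" if ch: "chief_factor G H A" "H \<subseteq> R" "x \<in> H" for H A x
  proof -
    have xG: "x \<in> carrier G" using ch chief_factorD(1) normal_subset by blast
    have "conjg G g x \<in> H" using ch chief_factorD(1)[OF ch(1)] G by (simp add: normal_conjg_iff)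
    then have "A #> conjg G h (conjg G g x) = A #> x"
      using g h ch by (auto simp: chief_centralizer_def)
    then show ?thesis using xG G by (simp add: conjg_conjg)
  qed
  then show "g \<otimes> h \<in> chief_centralizer G R" using G by (auto simp: chief_centralizer_def)
qed (auto simp: chief_centralizer_def)

text \<open>Every chief factor below \<open>R\<close> is cyclic of exponent \<open>p\<close>, so
  \<open>t\<close> raises its generator to some power \<open>u\<close>; as the order of
  \<open>t\<close> is a power of \<open>p\<close>, \<open>conjg_eq_self_of_prime_order\<close> makes
  this action trivial.\<close>

theorem (in fin_group) p_element_in_chief_centralizer:
  fixes p :: nat
  assumes p: "Factorial_Ring.prime p" and R: "is_p_subgroup p G R" and hyp: "hypercentral G R"
    and t: "t \<in> carrier G" "t [^] (p ^ e) = \<one>"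
  shows "t \<in> chief_centralizer G R"
proof -
  have "A #> conjg G t x = A #> x" if ch: "chief_factor G H A" "H \<subseteq> R" and x: "x \<in> H" for H A x
  proof -
    note c = chief_factorD[OF ch(1)]
    interpret A: normal A G by (rule c(2))
    interpret Q: group "G Mod A" by (rule A.factorgroup_is_group)
    have H: "subgroup H G" using c normal_imp_subgroup by blast
    have HG: "H \<subseteq> carrier G" using c normal_subset by blast
    have cyc: "cyclic_mod G H A" using hyp ch by (auto simp: hypercentral_def)
    obtain n where "card R = p ^ n" "subgroup R G" using R by (auto simp: is_p_subgroup_def)
    then obtain r where r: "card H = p ^ r" using card_subgroup_dvd[OF H _ ch(2)] dvd_prime_power_nat[OF p] by metis
    obtain a where a: "a \<in> H" "\<And>x. x \<in> H \<Longrightarrow> \<exists>i::int. A #> x = (A #> a) [^]\<^bsub>G Mod A\<^esub> i"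
      using cyclic_modD[OF c(2) HG cyc] by blast
    have aG: "a \<in> carrier G" using a HG by blast
    let ?a = "A #> a" and ?t = "A #> t"
    have Q: "?a \<in> carrier (G Mod A)" "?t \<in> carrier (G Mod A)" using aG t A.FactGroup_closed by auto
    have ap: "?a [^]\<^bsub>G Mod A\<^esub> p = \<one>\<^bsub>G Mod A\<^esub>"
      using chief_factor_exponent[OF p ch(1) cyc r a(1)] A.FactGroup_pow[OF aG, of p] A.rcos_eq_self_iff aG by auto
    have tp: "?t [^]\<^bsub>G Mod A\<^esub> (p ^ e) = \<one>\<^bsub>G Mod A\<^esub>"
      using A.FactGroup_pow[OF t(1), of "p ^ e"] t A.rcos_eq_self_iff[of \<one>] by auto
    have "conjg G t a \<in> H" using c(1) a t by (simp add: normal_conjg_iff)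
    then obtain i :: int where i: "A #> conjg G t a = ?a [^]\<^bsub>G Mod A\<^esub> i" using a(2) by blast
    \<comment> \<open>The integer exponent is reduced modulo \<open>p\<close> to a natural number,
      as \<open>conjg_eq_self_of_prime_order\<close> requires.\<close>
    define u where "u = nat (i mod int p)"
    have u: "int u = i mod int p" using prime_gt_0_nat[OF p] by (simp add: u_def)
    have "?a [^]\<^bsub>G Mod A\<^esub> i = ?a [^]\<^bsub>G Mod A\<^esub> (int p * (i div int p) + int u)" by (simp add: u)
    also have "\<dots> = (?a [^]\<^bsub>G Mod A\<^esub> int p) [^]\<^bsub>G Mod A\<^esub> (i div int p) \<otimes>\<^bsub>G Mod A\<^esub> ?a [^]\<^bsub>G Mod A\<^esub> int u"
      using Q(1) by (simp only: Q.int_pow_mult Q.int_pow_pow)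
    also have "\<dots> = ?a [^]\<^bsub>G Mod A\<^esub> u"
      using ap Q(1) Q.nat_pow_closed[OF Q(1), of u] by (simp only: int_pow_int Q.int_pow_one Q.l_one)
    finally have "conjg (G Mod A) ?t ?a = ?a [^]\<^bsub>G Mod A\<^esub> u"
      using i A.FactGroup_conjg[OF t(1) aG] by simp
    then have ta: "conjg (G Mod A) ?t ?a = ?a"
      using Q.conjg_eq_self_of_prime_order[OF p Q(2) tp Q(1) ap] by blast
    obtain j :: int where j: "A #> x = ?a [^]\<^bsub>G Mod A\<^esub> j" using a(2)[OF x] by blast
    have "conjg (G Mod A) ?t (A #> x) = A #> x"
      unfolding j using Q.conjg_int_pow[OF Q(2,1)] ta by simp
    then show ?thesis using A.FactGroup_conjg[OF t(1), of x] x HG by auto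
  qed
  then show ?thesis using t by (auto simp: chief_centralizer_def)
qed

text \<open>Coprime action: for a chief factor \<open>L/A\<close>, \<open>k\<close> centralizes
  \<open>A\<close> by induction and acts trivially on \<open>L/A\<close>. So it sends
  \<open>x\<close> to \<open>y \<otimes> x\<close> with \<open>y\<close> in \<open>A\<close> fixed
  by \<open>k\<close>, and the order of \<open>y\<close> divides both \<open>m\<close> and a power
  of \<open>p\<close>.\<close>

theorem (in fin_group) p'_element_of_chief_centralizer:
  fixes p m :: nat
  assumes R: "R \<lhd> G" and cR: "card R = p ^ r"
    and k: "k \<in> chief_centralizer G R" "k [^] m = \<one>" "coprime m p"
  shows "k \<in> centralizer_of G R"
proof -
  have kG: "k \<in> carrier G" using k by (simp add: chief_centralizer_def)
  have "\<forall>x\<in>L. conjg G k x = x" if "L \<lhd> G" "L \<subseteq> R" for L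
    using that
  proof (induction "card L" arbitrary: L rule: less_induct)
    case less
    show ?case
    proof (cases "L = {\<one>}")
      case True
      then show ?thesis using kG by simp
    next
      case False
      then obtain A where A: "chief_factor G L A" using chief_factor_below less.prems by blast
      note c = chief_factorD[OF A]
      have "finite L" using normal_subset[OF c(1)] fin finite_subset by blast
      then have "card A < card L" using c by (simp add: psubset_card_mono)
      then have IH: "conjg G k x = x" if "x \<in> A" for x using less.hyps c less.prems that by blast
      have sA: "subgroup A G" using c normal_imp_subgroup by blast
      have AG: "A \<subseteq> carrier G" using c normal_subset by blast
      show ?thesis
      proof
        fix x assume x: "x \<in> L"
        then have xG: "x \<in> carrier G" using c normal_subset by blast
        have "A #> conjg G k x = A #> x" using k A less.prems x by (auto simp: chief_centralizer_def)
        then have yA: "conjg G k x \<otimes> inv x \<in> A" using rcos_eq_iff[OF sA] xG kG by simp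
        define y where "y = conjg G k x \<otimes> inv x"
        have y: "y \<in> A" "y \<in> carrier G" using yA xG kG by (auto simp: y_def)
        have yx: "conjg G k x = y \<otimes> x" using xG kG by (simp add: y_def m_assoc)
        \<comment> \<open>Since \<open>k\<close> fixes \<open>y\<close>, each application of
          \<open>k\<close> contributes another factor \<open>y\<close>; at \<open>j = m\<close> this
          gives \<open>y [^] m = \<one>\<close>.\<close>
        have "conjg G (k [^] j) x = y [^] j \<otimes> x" for j :: nat
        proof (induction j)
          case (Suc j)
          have "conjg G (k [^] Suc j) x = conjg G k (y [^] j \<otimes> x)"
            using Suc kG xG by (simp flip: conjg_conjg)
          also have "\<dots> = conjg G k (y [^] j) \<otimes> (y \<otimes> x)" using kG xG y yx by (simp add: conjg_mult)
          also have "\<dots> = y [^] j \<otimes> (y \<otimes> x)"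
            using IH y(1) sA by (simp add: subgroup_nat_pow_closed)
          finally show ?case using y xG by (simp add: m_assoc)
        qed (use xG in simp)
        from this[of m] have "x = y [^] m \<otimes> x" using k xG by simp
        then have "y [^] m = \<one>" using xG y by (metis nat_pow_closed one_closed l_one right_cancel)
        moreover have "y [^] (p ^ r) = \<one>"
          using pow_card_subgroup[OF normal_imp_subgroup[OF R]] cR y(1) c less.prems by (metis psubsetD subsetD)
        ultimately have "ord y dvd m" "ord y dvd p ^ r" using y pow_eq_id by auto
        then have "ord y = 1" using k(3) by (metis coprime_common_divisor_nat coprime_power_right_iff)
        then have "y = \<one>" using y ord_eq_1 by blast
        then show "conjg G k x = x" using yx xG by simp
      qed
    qed
  qed
  then show ?thesis using R kG by (auto simp: centralizer_of_def)
qed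

subsection \<open>Control of fusion by the normalizer of a Sylow subgroup\<close>

lemma (in fin_group) sylow_subgroup_of_subgroup:
  fixes p :: nat
  assumes p: "Factorial_Ring.prime p" and T: "sylow_subgroup p G T" and K: "subgroup K G" and TK: "T \<subseteq> K"
  shows "sylow_subgroup p (G\<lparr>carrier := K\<rparr>) T"
proof -
  have T': "subgroup T G" "card T = p ^ multiplicity p (order G)" using T by (auto simp: sylow_subgroup_def)
  have "card T dvd card K" by (rule card_subgroup_dvd[OF T'(1) K TK])
  then have "multiplicity p (order G) \<le> multiplicity p (card K)"
    using T' p card_subgroup_pos[OF K] by (intro multiplicity_geI) auto
  moreover have "card K dvd order G" using lagrange[OF K] by (metis dvd_triv_right)
  then have "multiplicity p (card K) \<le> multiplicity p (order G)"
    using order_pos by (intro dvd_imp_multiplicity_le) auto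
  ultimately show ?thesis using T' K TK by (simp add: sylow_subgroup_def subgroup_subgroup_iff order_def)
qed

text \<open>A Sylow subgroup \<open>Y\<close> of \<open>C\<close> can be conjugated into
  \<open>T\<close>, and the conjugate stays in the normal subgroup \<open>C\<close>; so
  \<open>T \<inter> C\<close> is at least as large as \<open>Y\<close>.\<close>

lemma (in fin_group) sylow_subgroup_Int_normal:
  fixes p :: nat
  assumes p: "Factorial_Ring.prime p" and T: "sylow_subgroup p G T" and C: "C \<lhd> G"
  shows "sylow_subgroup p (G\<lparr>carrier := C\<rparr>) (T \<inter> C)"
proof -
  have sC: "subgroup C G" using C normal_imp_subgroup by blast
  have T': "subgroup T G" "card T = p ^ multiplicity p (order G)" using T by (auto simp: sylow_subgroup_def)
  interpret C: fin_group "G\<lparr>carrier := C\<rparr>" using sC fin_group_subgroup by blast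
  obtain Y where Y: "sylow_subgroup p (G\<lparr>carrier := C\<rparr>) Y" using C.sylow_subgroup_exists[OF p] .
  then have Y': "subgroup Y G" "Y \<subseteq> C" and cY: "card Y = p ^ multiplicity p (order (G\<lparr>carrier := C\<rparr>))"
    using sC by (auto simp: sylow_subgroup_def subgroup_subgroup_iff)
  obtain g where g: "g \<in> carrier G" "conjg G g ` Y \<subseteq> T" using sylow_conjugate[OF p T Y'(1) cY] .
  have "conjg G g ` Y \<subseteq> C" using normal_conjg_image[OF C g(1)] Y' by blast
  then have "card (conjg G g ` Y) \<le> card (T \<inter> C)"
    using g finite_subgroup[OF T'(1)] by (intro card_mono) auto
  then have le: "card Y \<le> card (T \<inter> C)" using card_conjg[OF g(1) subgroup.subset[OF Y'(1)]] by simp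
  have TC: "subgroup (T \<inter> C) G" using T' sC subgroups_Inter_pair by blast
  obtain n where n: "card (T \<inter> C) = p ^ n"
    using card_subgroup_dvd[OF TC T'(1)] T' dvd_prime_power_nat[OF p] by auto
  show ?thesis
    by (rule C.sylow_card_ge[OF p Y _ n le]) (use TC sC in \<open>simp add: subgroup_subgroup_iff\<close>)
qed

text \<open>\<open>C\<close> is normal, so conjugation by \<open>n\<close> sends
  \<open>T \<inter> C\<close> to another subgroup of \<open>C\<close> of the same order; Sylow's
  theorem in \<open>C\<close> yields the \<open>c\<close> that moves it back.\<close>

theorem (in fin_group) frattini:
  fixes p :: nat
  assumes p: "Factorial_Ring.prime p" and T: "sylow_subgroup p G T" and C: "C \<lhd> G" and n: "n \<in> carrier G"
  obtains c where "c \<in> C" "n \<otimes> c \<in> normalizer_of G (T \<inter> C)"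
proof -
  have sC: "subgroup C G" using C normal_imp_subgroup by blast
  interpret C: fin_group "G\<lparr>carrier := C\<rparr>" using sC fin_group_subgroup by blast
  have TC: "sylow_subgroup p (G\<lparr>carrier := C\<rparr>) (T \<inter> C)" by (rule sylow_subgroup_Int_normal[OF p T C])
  then have sTC: "subgroup (T \<inter> C) G" and cTC: "card (T \<inter> C) = p ^ multiplicity p (order (G\<lparr>carrier := C\<rparr>))"
    using sC by (auto simp: sylow_subgroup_def subgroup_subgroup_iff)
  have TCG: "T \<inter> C \<subseteq> carrier G" using sTC subgroup.subset by blast
  have "conjg G n ` (T \<inter> C) \<subseteq> C" using normal_conjg_image[OF C n] by blast
  then have "subgroup (conjg G n ` (T \<inter> C)) (G\<lparr>carrier := C\<rparr>)"
    using subgroup_conjg[OF n sTC] sC by (simp add: subgroup_subgroup_iff)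
  from C.sylow_conjugate[OF p TC this]
  obtain c where c': "c \<in> carrier (G\<lparr>carrier := C\<rparr>)"
    "conjg (G\<lparr>carrier := C\<rparr>) c ` conjg G n ` (T \<inter> C) \<subseteq> T \<inter> C"
    using card_conjg[OF n TCG] cTC by metis
  then have c: "c \<in> C" "conjg (G\<lparr>carrier := C\<rparr>) c ` conjg G n ` (T \<inter> C) \<subseteq> T \<inter> C" by simp_all
  have cG: "c \<in> carrier G" using c(1) normal_subset[OF C] by blast
  have "conjg G (n \<otimes> c) ` (T \<inter> C) \<subseteq> T \<inter> C"
    using c n cG TCG by (simp add: conjg_consistent[OF sC] flip: conjg_image_conjg)
  then have "n \<otimes> c \<in> normalizer_of G (T \<inter> C)" using normalizer_ofI n cG TCG by simp
  with c show thesis using that by blast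
qed

lemma (in group) centralizer_of_normal:
  assumes R: "R \<lhd> G" shows "centralizer_of G R \<lhd> G"
proof -
  have RG: "R \<subseteq> carrier G" using normal_subset[OF R] .
  have "conjg G g c \<in> centralizer_of G R" if g: "g \<in> carrier G" and c: "c \<in> centralizer_of G R" for g c
  proof -
    have cG: "c \<in> carrier G" using c by (simp add: centralizer_of_def)
    have "conjg G (conjg G g c) x = x" if x: "x \<in> R" for x
    proof -
      have xG: "x \<in> carrier G" using x RG by blast
      have "conjg G (inv g) x \<in> R" using R g x by (simp add: normal_conjg_iff)
      then have "conjg G c (conjg G (inv g) x) = conjg G (inv g) x" using c by (simp add: centralizer_of_def)
      then have "conjg G g (conjg G c (conjg G (inv g) x)) = x" using g xG by simp
      moreover have "conjg G (conjg G g c) x = conjg G g (conjg G c (conjg G (inv g) x))"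
        using g cG xG by (simp add: conjg_conjg) (simp add: conjg_def m_assoc)
      ultimately show ?thesis by simp
    qed
    then show ?thesis using g cG by (simp add: centralizer_of_def)
  qed
  then show ?thesis using subgroup_centralizer_of[OF RG] by (simp add: normal_conjg_iff)
qed

lemma (in group) centralizer_of_le_chief_centralizer: "centralizer_of G R \<subseteq> chief_centralizer G R"
  by (auto simp: centralizer_of_def chief_centralizer_def subset_iff)

text \<open>The centralizer \<open>K\<close> of the chief factors below \<open>R\<close> contains every \<open>p\<close>-element, and its elements of
  order prime to \<open>p\<close> centralize \<open>R\<close>; hence it is the product of \<open>C(R)\<close> and a Sylow subgroup of \<open>G\<close>.\<close>

lemma (in fin_group) chief_centralizer_eq_set_mult:
  fixes p :: nat
  assumes p: "Factorial_Ring.prime p" and T: "sylow_subgroup p G T" and R: "R \<lhd> G" "is_p_subgroup p G R"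
    and TK: "T \<subseteq> chief_centralizer G R"
  shows "chief_centralizer G R = centralizer_of G R <#> T"
proof -
  let ?K = "chief_centralizer G R" and ?C = "centralizer_of G R"
  have K: "subgroup ?K G" by (rule subgroup_chief_centralizer)
  have T': "subgroup T G" "card T = p ^ multiplicity p (order G)" using T by (auto simp: sylow_subgroup_def)
  have Cn: "?C \<lhd> G" by (rule centralizer_of_normal[OF R(1)])
  have sC: "subgroup ?C G" using Cn normal_imp_subgroup by blast
  have CT: "subgroup (?C <#> T) G" by (rule mult_norm_subgroup[OF Cn T'(1)])
  have le: "?C <#> T \<subseteq> ?K" by (rule set_mult_subset_subgroup[OF K centralizer_of_le_chief_centralizer TK])
  obtain r where r: "card R = p ^ r" using R by (auto simp: is_p_subgroup_def)
  interpret K: fin_group "G\<lparr>carrier := ?K\<rparr>" using K fin_group_subgroup by blast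
  \<comment> \<open>Divisibility is checked one prime at a time: \<open>T\<close> accounts for
    \<open>p\<close>, and a Sylow subgroup of \<open>?K\<close> for any other prime centralizes
    \<open>R\<close>.\<close>
  have "card ?K dvd card (?C <#> T)"
  proof (rule multiplicity_le_imp_dvd)
    show "card ?K \<noteq> 0" using card_subgroup_pos[OF K] by simp
    fix q :: nat assume q: "Factorial_Ring.prime q"
    have "q ^ multiplicity q (card ?K) dvd card (?C <#> T)"
    proof (cases "q = p")
      case True
      have "card T = q ^ multiplicity q (card ?K)"
        using sylow_subgroup_of_subgroup[OF p T K TK] True by (simp add: sylow_subgroup_def order_def)
      then show ?thesis using card_subgroup_dvd[OF T'(1) CT subset_set_mult(2)[OF sC T'(1)]] by metis
    next
      case False
      obtain X where "sylow_subgroup q (G\<lparr>carrier := ?K\<rparr>) X" using K.sylow_subgroup_exists[OF q] .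
      then have X: "subgroup X G" "X \<subseteq> ?K" "card X = q ^ multiplicity q (card ?K)"
        using K by (auto simp: sylow_subgroup_def subgroup_subgroup_iff order_def)
      have "coprime q p" using p q False primes_coprime by blast
      then have "coprime (card X) p" using X by simp
      then have "X \<subseteq> ?C" using p'_element_of_chief_centralizer[OF R(1) r] pow_card_subgroup[OF X(1)] X(2) by blast
      then have "X \<subseteq> ?C <#> T" using subset_set_mult(1)[OF sC T'(1)] by blast
      then show ?thesis using card_subgroup_dvd[OF X(1) CT] X(3) by metis
    qed
    then show "multiplicity q (card ?K) \<le> multiplicity q (card (?C <#> T))"
      using card_subgroup_pos[OF CT] q by (intro multiplicity_geI) auto
  qed
  then have "card ?K \<le> card (?C <#> T)" using card_subgroup_pos[OF CT] dvd_imp_le by blast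
  then show ?thesis using subgroup_card_eq[OF K le] by simp
qed

theorem (in fin_group) frattini_hypercentral:
  fixes p :: nat
  assumes p: "Factorial_Ring.prime p" and T: "sylow_subgroup p G T" and R: "R \<lhd> G" "is_p_subgroup p G R"
    and hyp: "hypercentral G R" and n: "n \<in> carrier G"
  obtains c where "c \<in> centralizer_of G R" "n \<otimes> c \<in> normalizer_of G T"
proof -
  let ?K = "chief_centralizer G R" and ?C = "centralizer_of G R"
  have K: "subgroup ?K G" by (rule subgroup_chief_centralizer)
  have T': "subgroup T G" "card T = p ^ multiplicity p (order G)" using T by (auto simp: sylow_subgroup_def)
  have TG: "T \<subseteq> carrier G" using T' subgroup.subset by blast
  have le: "X \<subseteq> ?K" if "subgroup X G" "card X = p ^ multiplicity p (order G)" for X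
    using p_element_in_chief_centralizer[OF p R(2) hyp] pow_card_subgroup[OF that(1)] that(2) subgroup.subset[OF that(1)]
    by (metis subset_iff)
  have KCT: "?K = ?C <#> T" by (rule chief_centralizer_eq_set_mult[OF p T R le[OF T']])
  have nT: "subgroup (conjg G n ` T) G" "card (conjg G n ` T) = p ^ multiplicity p (order G)"
    using subgroup_conjg n T' card_conjg TG by auto
  interpret K: fin_group "G\<lparr>carrier := ?K\<rparr>" using K fin_group_subgroup by blast
  have TK: "sylow_subgroup p (G\<lparr>carrier := ?K\<rparr>) T" by (rule sylow_subgroup_of_subgroup[OF p T K le[OF T']])
  have "subgroup (conjg G n ` T) (G\<lparr>carrier := ?K\<rparr>)"
    using nT le[OF nT] K by (simp add: subgroup_subgroup_iff)
  from K.sylow_conjugate[OF p TK this nT(2)]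
  obtain k where "k \<in> carrier (G\<lparr>carrier := ?K\<rparr>)" "conjg (G\<lparr>carrier := ?K\<rparr>) k ` conjg G n ` T \<subseteq> T" .
  then have k: "k \<in> ?K" "conjg (G\<lparr>carrier := ?K\<rparr>) k ` conjg G n ` T \<subseteq> T" by simp_all
  obtain c t where ct: "c \<in> ?C" "t \<in> T" "k = c \<otimes> t" using k(1) KCT by (auto simp: set_mult_def)
  have G: "c \<in> carrier G" "t \<in> carrier G" using ct TG by (auto simp: centralizer_of_def)
  have "conjg G t ` conjg G (n \<otimes> c) ` T \<subseteq> T"
    using k G n TG by (simp add: conjg_consistent[OF K] ct(3) conjg_image_conjg m_assoc)
  then have "conjg G (inv t) ` conjg G t ` conjg G (n \<otimes> c) ` T \<subseteq> conjg G (inv t) ` T" by (rule image_mono)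
  also have "conjg G (inv t) ` T = T" using subgroup_conjg_self T' ct subgroup.m_inv_closed by metis
  finally have "conjg G (n \<otimes> c) ` T \<subseteq> T"
    using G n TG by (simp add: conjg_image_conjg m_assoc)
  then have "n \<otimes> c \<in> normalizer_of G T" using normalizer_ofI G n TG by simp
  with ct show thesis using that by blast
qed

section \<open>Reduction of fusion to the normalizer of a Sylow subgroup\<close>

definition controls :: "('a, 'b) monoid_scheme \<Rightarrow> 'a set \<Rightarrow> 'a set \<Rightarrow> 'a \<Rightarrow> bool" where
  "controls G S P g \<longleftrightarrow> (\<exists>n\<in>normalizer_of G S. \<forall>x\<in>P. conjg G g x = conjg G n x)"

lemma (in group) normalizer_of_subgroup:
  "subgroup K G \<Longrightarrow> normalizer_of (G\<lparr>carrier := K\<rparr>) H = normalizer_of G H \<inter> K"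
  using subgroup.subset by (auto simp: normalizer_of_def conjg_consistent) 

lemma (in group) centralizer_of_subgroup:
  "subgroup K G \<Longrightarrow> centralizer_of (G\<lparr>carrier := K\<rparr>) H = centralizer_of G H \<inter> K"
  using subgroup.subset by (auto simp: centralizer_of_def conjg_consistent)

lemma (in fin_group) p_subgroup_normalizer_grows:
  fixes p :: nat
  assumes p: "Factorial_Ring.prime p" and S: "subgroup S G" "card S = p ^ s"
    and R: "subgroup R G" "R \<subset> S"
  shows "R \<subset> S \<inter> normalizer_of G R"
proof -
  interpret S: fin_group "G\<lparr>carrier := S\<rparr>" using S fin_group_subgroup by blast
  obtain g where "g \<in> normalizer_of (G\<lparr>carrier := S\<rparr>) R" "g \<notin> R"
    using S.p_group_normalizer_grows[OF p, of s R] S R by (auto simp: order_def subgroup_subgroup_iff)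
  then show ?thesis using R subgroup_subset_normalizer_of[OF R(1)] by (auto simp: normalizer_of_subgroup[OF S(1)])
qed

text \<open>The two alternatives for \<open>R\<close> exclude that \<open>R\<close> is essential in the sense of Alperin's fusion theorem.\<close>

lemma (in fin_group) controls_normalizer:
  fixes p :: nat
  assumes p: "Factorial_Ring.prime p" and S: "subgroup S G" "card S = p ^ s"
    and R: "subgroup R G" "R \<subset> S"
    and T: "sylow_subgroup p (G\<lparr>carrier := normalizer_of G R\<rparr>) (S \<inter> normalizer_of G R)"
    and alt: "(\<exists>H. subgroup H G \<and> R \<subset> H \<and> H \<subseteq> S \<and> comm_group (G\<lparr>carrier := H\<rparr>)) \<or>
      hypercentral (G\<lparr>carrier := normalizer_of G R\<rparr>) R"
    and IH: "\<And>P g. \<lbrakk>subgroup P G; P \<subseteq> S; card R < card P; g \<in> carrier G; conjg G g ` P \<subseteq> S\<rbrakk> \<Longrightarrow> controls G S P g"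
    and g: "g \<in> normalizer_of G R"
  shows "controls G S R g"
proof -
  let ?N = "normalizer_of G R" and ?M = "G\<lparr>carrier := normalizer_of G R\<rparr>"
  have RG: "R \<subseteq> carrier G" using R subgroup.subset by blast
  have SG: "S \<subseteq> carrier G" using S subgroup.subset by blast
  have N: "subgroup ?N G" by (rule subgroup_normalizer_of[OF RG])
  interpret M: fin_group ?M using N fin_group_subgroup by blast
  have RM: "R \<lhd> ?M" by (rule normal_normalizer_of[OF R(1)])
  have gM: "g \<in> carrier ?M" using g by simp
  have sT: "subgroup (S \<inter> ?N) G" using S N subgroups_Inter_pair by blast
  have "\<exists>U c. subgroup U G \<and> R \<subset> U \<and> U \<subseteq> S \<and> c \<in> centralizer_of G R \<and> g \<otimes> c \<in> normalizer_of G U"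
    using alt
  proof
    assume "\<exists>H. subgroup H G \<and> R \<subset> H \<and> H \<subseteq> S \<and> comm_group (G\<lparr>carrier := H\<rparr>)"
    then obtain H where H: "subgroup H G" "R \<subset> H" "H \<subseteq> S" "comm_group (G\<lparr>carrier := H\<rparr>)" by blast
    interpret H: comm_group "G\<lparr>carrier := H\<rparr>" by (rule H(4))
    let ?C = "centralizer_of ?M R"
    have C: "?C \<lhd> ?M" by (rule M.centralizer_of_normal[OF RM])
    obtain c where c: "c \<in> ?C" "g \<otimes>\<^bsub>?M\<^esub> c \<in> normalizer_of ?M (S \<inter> ?N \<inter> ?C)"
      using M.frattini[OF p T C gM] .
    have "conjg G h x = x" if "h \<in> H" "x \<in> H" for h x
    proof -
      have "x \<otimes> h = h \<otimes> x" using H.m_comm[of x h] that by simp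
      then show ?thesis using subgroup.mem_carrier[OF H(1)] that by (simp add: conjg_def m_assoc) (simp flip: m_assoc)
    qed
    \<comment> \<open>\<open>H\<close> is abelian and contains \<open>R\<close>, so it centralizes
      \<open>R\<close>; this makes \<open>S \<inter> ?N \<inter> ?C\<close> larger than
      \<open>R\<close>.\<close>
    then have hC: "H \<subseteq> centralizer_of G R" using H(1,2) subgroup.subset by (fastforce simp: centralizer_of_def)
    moreover have "centralizer_of G R \<subseteq> ?N" by (auto simp: centralizer_of_def normalizer_of_def)
    ultimately have "H \<subseteq> S \<inter> ?N \<inter> ?C" using H(3) by (auto simp: centralizer_of_subgroup[OF N])
    moreover have "subgroup (S \<inter> ?N \<inter> ?C) G"
      using normal_imp_subgroup[OF C] N by (intro subgroups_Inter_pair[OF sT]) (simp add: subgroup_subgroup_iff)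
    ultimately show ?thesis using H(2) c
      by (intro exI[of _ "S \<inter> ?N \<inter> ?C"] exI[of _ c]) (auto simp: normalizer_of_subgroup[OF N] centralizer_of_subgroup[OF N])
  next
    assume hyp: "hypercentral ?M R"
    obtain r where r: "card R = p ^ r" using card_subgroup_dvd[OF R(1) S(1) psubset_imp_subset[OF R(2)]] S(2) dvd_prime_power_nat[OF p] by metis
    have "is_p_subgroup p ?M R" using normal_imp_subgroup[OF RM] r by (auto simp: is_p_subgroup_def)
    from M.frattini_hypercentral[OF p T RM this hyp gM]
    obtain c where c: "c \<in> centralizer_of ?M R" "g \<otimes>\<^bsub>?M\<^esub> c \<in> normalizer_of ?M (S \<inter> ?N)" .
    then show ?thesis using p_subgroup_normalizer_grows[OF p S R] sT
      by (intro exI[of _ "S \<inter> ?N"] exI[of _ c]) (auto simp: normalizer_of_subgroup[OF N] centralizer_of_subgroup[OF N])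
  qed
  then obtain U c where U: "subgroup U G" "R \<subset> U" "U \<subseteq> S" and c: "c \<in> centralizer_of G R" "g \<otimes> c \<in> normalizer_of G U" by blast
  have G: "g \<in> carrier G" "c \<in> carrier G" using g c by (auto simp: normalizer_of_def centralizer_of_def)
  have "card R < card U" using U finite_subgroup by (simp add: psubset_card_mono)
  moreover have "conjg G (g \<otimes> c) ` U \<subseteq> S" using normalizer_ofD(2)[OF c(2)] U by simp
  ultimately have "controls G S U (g \<otimes> c)" using IH[of U "g \<otimes> c"] U(1,3) G by simp
  then obtain n where n: "n \<in> normalizer_of G S" "\<And>x. x \<in> U \<Longrightarrow> conjg G (g \<otimes> c) x = conjg G n x"
    unfolding controls_def by blast
  \<comment> \<open>\<open>g\<close> maps \<open>R\<close> to itself and \<open>c\<close>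
    centralizes \<open>R\<close>, so \<open>g\<close> and \<open>g \<otimes> c\<close> agree on
    \<open>R\<close>.\<close>
  have "conjg G g x = conjg G n x" if x: "x \<in> R" for x
  proof -
    have "conjg G g x \<in> R" using normalizer_ofD(2)[OF g] x by blast
    then have "conjg G c (conjg G g x) = conjg G g x" using c by (simp add: centralizer_of_def)
    moreover have "conjg G c (conjg G g x) = conjg G (g \<otimes> c) x" using G x RG by (auto simp: conjg_conjg)
    ultimately show ?thesis using n(2)[of x] x U by auto
  qed
  then show ?thesis using n by (auto simp: controls_def)
qed

lemma (in group) normalizer_of_conjg:
  assumes H: "H \<subseteq> carrier G" and y: "y \<in> carrier G"
  shows "normalizer_of G (conjg G y ` H) = conjg G y ` normalizer_of G H"
proof -
  have *: "conjg G y g \<in> normalizer_of G (conjg G y ` H)" if "y \<in> carrier G" "g \<in> normalizer_of G H" "H \<subseteq> carrier G" for y g H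
  proof -
    have g: "g \<in> carrier G" "conjg G g ` H = H" using that by (auto simp: normalizer_of_def)
    have "conjg G (conjg G y g) ` conjg G y ` H = conjg G (y \<otimes> conjg G y g) ` H"
      using that g by (simp add: conjg_image_conjg)
    also have "y \<otimes> conjg G y g = g \<otimes> y" using that(1) g by (simp add: conjg_def flip: m_assoc)
    also have "conjg G (g \<otimes> y) ` H = conjg G y ` H" using that g by (simp flip: conjg_image_conjg)
    finally show ?thesis using that(1) g by (simp add: normalizer_of_def)
  qed
  show ?thesis
  proof
    show "conjg G y ` normalizer_of G H \<subseteq> normalizer_of G (conjg G y ` H)" using * H y by blast
    show "normalizer_of G (conjg G y ` H) \<subseteq> conjg G y ` normalizer_of G H"
    proof
      fix g assume g: "g \<in> normalizer_of G (conjg G y ` H)"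
      then have gG: "g \<in> carrier G" by (rule normalizer_ofD)
      have "conjg G (inv y) g \<in> normalizer_of G (conjg G (inv y) ` conjg G y ` H)"
        using *[of "inv y" g "conjg G y ` H"] g y conjg_subset[OF y H] by simp
      also have "conjg G (inv y) ` conjg G y ` H = H" using y H by (simp add: conjg_image_conjg conjg_image_one)
      finally show "g \<in> conjg G y ` normalizer_of G H" using y gG by (metis conjg_inv_right imageI)
    qed
  qed
qed

text \<open>\<open>P\<close> and its conjugate \<open>Q\<close> are both moved to a conjugate
  \<open>R\<close> of \<open>P\<close> whose normalizer has
  \<open>S \<inter> normalizer_of G R\<close> as a Sylow subgroup. The moves \<open>v\<close> and
  \<open>w\<close> carry the strictly larger groups \<open>S \<inter> normalizer_of G P\<close> and
  \<open>S \<inter> normalizer_of G Q\<close> into \<open>S\<close>, so induction applies to them;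
  what remains is \<open>z\<close>, which normalizes \<open>R\<close> and falls under
  \<open>controls_normalizer\<close>.\<close>

theorem (in fin_group) normalizer_controls_fusion:
  fixes p :: nat
  assumes p: "Factorial_Ring.prime p" and S: "sylow_subgroup p G S"
    and alt: "\<And>R. \<lbrakk>subgroup R G; R \<subset> S;
        sylow_subgroup p (G\<lparr>carrier := normalizer_of G R\<rparr>) (S \<inter> normalizer_of G R)\<rbrakk> \<Longrightarrow>
      (\<exists>H. subgroup H G \<and> R \<subset> H \<and> H \<subseteq> S \<and> comm_group (G\<lparr>carrier := H\<rparr>)) \<or>
      hypercentral (G\<lparr>carrier := normalizer_of G R\<rparr>) R"
    and "subgroup P G" "P \<subseteq> S" "g \<in> carrier G" "conjg G g ` P \<subseteq> S"
  shows "controls G S P g"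
  using assms(4-)
proof (induction "card S - card P" arbitrary: P g rule: less_induct)
  case less
  note P = less.prems(1,2) and g = less.prems(3,4)
  let ?s = "multiplicity p (order G)"
  have S': "subgroup S G" "card S = p ^ ?s" using S by (auto simp: sylow_subgroup_def)
  have SG: "S \<subseteq> carrier G" using S' subgroup.subset by blast
  have PG: "P \<subseteq> carrier G" using P SG by blast
  have finS: "finite S" using SG fin finite_subset by blast
  show ?case
  proof (cases "P = S")
    case True
    then have "g \<in> normalizer_of G S" using g normalizer_ofI SG by blast
    then show ?thesis by (auto simp: controls_def)
  next
    case False
    then have PS: "P \<subset> S" using P by blast
    have lt: "card P < card S" using PS finS by (simp add: psubset_card_mono)
    have IH: "controls G S P' g'" if "subgroup P' G" "P' \<subseteq> S" "card P < card P'" "g' \<in> carrier G" "conjg G g' ` P' \<subseteq> S" for P' g'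
    proof (rule less.hyps)
      show "card S - card P' < card S - card P" using that lt by simp
    qed (use that in auto)
    have psub: "\<exists>n. card H = p ^ n" if "subgroup H G" "H \<subseteq> S" for H
      using card_subgroup_dvd[OF that(1) S'(1) that(2)] S'(2) dvd_prime_power_nat[OF p] by auto
    let ?N = "normalizer_of G P"
    have N: "subgroup ?N G" by (rule subgroup_normalizer_of[OF PG])
    interpret N: fin_group "G\<lparr>carrier := ?N\<rparr>" using N fin_group_subgroup by blast
    obtain X where X: "sylow_subgroup p (G\<lparr>carrier := ?N\<rparr>) X" using N.sylow_subgroup_exists[OF p] .
    then have X': "subgroup X G" "X \<subseteq> ?N" "card X = p ^ multiplicity p (card ?N)"
      using N by (auto simp: sylow_subgroup_def subgroup_subgroup_iff order_def)
    have XG: "X \<subseteq> carrier G" using X' subgroup.subset by blast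
    \<comment> \<open>\<open>y\<close> brings a full Sylow subgroup of \<open>?N\<close> into
      \<open>S\<close>; this is what will give the conjugate \<open>R\<close> of \<open>P\<close> by
      \<open>y\<close> the required Sylow subgroup in its normalizer.\<close>
    obtain y where y: "y \<in> carrier G" "conjg G y ` X \<subseteq> S" using sylow_conjugate[OF p S X'(1,3)] .
    \<comment> \<open>A \<open>p\<close>-subgroup of \<open>?N\<close> is first conjugated into
      \<open>X\<close> within \<open>?N\<close>, which keeps \<open>P\<close> in place, and then by
      \<open>y\<close> into \<open>S\<close>.\<close>
    have into: "\<exists>n\<in>?N. conjg G (n \<otimes> y) ` Y \<subseteq> S" if Y: "subgroup Y G" "Y \<subseteq> ?N" "\<exists>k. card Y = p ^ k" for Y
    proof -
      have YG: "Y \<subseteq> carrier G" using Y subgroup.subset by blast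
      have "subgroup Y (G\<lparr>carrier := ?N\<rparr>)" using Y N by (simp add: subgroup_subgroup_iff)
      from N.sylow_conjugate[OF p X this] Y(3)
      obtain n where "n \<in> carrier (G\<lparr>carrier := ?N\<rparr>)" "conjg (G\<lparr>carrier := ?N\<rparr>) n ` Y \<subseteq> X" by metis
      then have n: "n \<in> ?N" "conjg (G\<lparr>carrier := ?N\<rparr>) n ` Y \<subseteq> X" by simp_all
      have nG: "n \<in> carrier G" using n normalizer_ofD by blast
      have "conjg G n ` Y \<subseteq> X" using n by (simp add: conjg_consistent[OF N])
      then have "conjg G y ` conjg G n ` Y \<subseteq> S" using y by blast
      then show ?thesis using n nG y YG by (auto simp: conjg_image_conjg)
    qed
    define Q where "Q = conjg G g ` P"
    have Q: "subgroup Q G" "Q \<subseteq> S" "card Q = card P"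
      using subgroup_conjg g P card_conjg PG by (auto simp: Q_def)
    have QG: "Q \<subseteq> carrier G" using Q SG by blast
    have "Q \<subset> S" using Q lt by auto
    then have Qgrow: "Q \<subset> S \<inter> normalizer_of G Q" by (rule p_subgroup_normalizer_grows[OF p S' Q(1)])
    have Pgrow: "P \<subset> S \<inter> normalizer_of G P" by (rule p_subgroup_normalizer_grows[OF p S' P(1) PS])
    have sNS: "subgroup (S \<inter> normalizer_of G H) G" if "H \<subseteq> carrier G" for H
      using S' subgroup_normalizer_of[OF that] subgroups_Inter_pair by blast
    obtain m where m: "m \<in> ?N" "conjg G (m \<otimes> y) ` (S \<inter> ?N) \<subseteq> S"
      using into[OF sNS[OF PG]] psub[OF sNS[OF PG]] by blast
    \<comment> \<open>\<open>inv g\<close> carries the normalizer of \<open>Q\<close> to that of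
      \<open>P\<close>, so \<open>into\<close> applies to this subgroup as well.\<close>
    let ?Y = "conjg G (inv g) ` (S \<inter> normalizer_of G Q)"
    have gQ: "conjg G (inv g) ` Q = P" using g(1) PG by (simp add: Q_def conjg_image_conjg conjg_image_one)
    have "?Y \<subseteq> normalizer_of G (conjg G (inv g) ` Q)" using normalizer_of_conjg[OF QG, of "inv g"] g by auto
    then have "?Y \<subseteq> ?N" by (simp add: gQ)
    moreover have "subgroup ?Y G" using subgroup_conjg[OF _ sNS[OF QG]] g by simp
    moreover have "\<exists>k. card ?Y = p ^ k"
      using psub[OF sNS[OF QG]] card_conjg[of "inv g" "S \<inter> normalizer_of G Q"] g SG by (simp add: le_infI1)
    ultimately obtain n where n: "n \<in> ?N" "conjg G (n \<otimes> y) ` ?Y \<subseteq> S" using into by blast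
    have nm: "n \<in> carrier G" "m \<in> carrier G" "conjg G n ` P = P" "conjg G m ` P = P"
      using n m by (auto simp: normalizer_of_def)
    define R where "R = conjg G y ` P"
    have R: "subgroup R G" "card R = card P" using subgroup_conjg y P card_conjg PG by (auto simp: R_def)
    have RG: "R \<subseteq> carrier G" using R subgroup.subset by blast
    define v w where "v = m \<otimes> y" and "w = inv g \<otimes> (n \<otimes> y)"
    have vw: "v \<in> carrier G" "w \<in> carrier G" using nm y g by (auto simp: v_def w_def)
    have vP: "conjg G v ` P = R" using nm y PG by (simp add: v_def R_def flip: conjg_image_conjg)
    have wQ: "conjg G w ` Q = R"
    proof -
      have "conjg G w ` Q = conjg G (n \<otimes> y) ` conjg G (inv g) ` Q"
        using g nm y QG by (simp add: w_def conjg_image_conjg)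
      also have "\<dots> = conjg G y ` conjg G n ` P" using nm(1) y PG by (simp only: gQ conjg_image_conjg)
      finally show ?thesis using nm by (simp add: R_def)
    qed
    have "R \<subseteq> S" using vP m Pgrow by (auto simp: v_def)
    then have RS: "R \<subset> S" using R lt by auto
    have "controls G S (S \<inter> normalizer_of G P) v"
      using IH[OF sNS[OF PG], of v] m vw psubset_card_mono[OF _ Pgrow] finS by (simp add: v_def)
    then obtain a where a: "a \<in> normalizer_of G S" "\<And>x. x \<in> P \<Longrightarrow> conjg G v x = conjg G a x"
      using Pgrow by (auto simp: controls_def)
    have "conjg G w ` (S \<inter> normalizer_of G Q) \<subseteq> S"
      using n(2) g nm y SG by (simp add: w_def conjg_image_conjg le_infI1)
    then have "controls G S (S \<inter> normalizer_of G Q) w"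
      using IH[OF sNS[OF QG], of w] vw psubset_card_mono[OF _ Qgrow] finS Q(3) by simp
    then obtain b where b: "b \<in> normalizer_of G S" "\<And>x. x \<in> Q \<Longrightarrow> conjg G w x = conjg G b x"
      using Qgrow by (auto simp: controls_def)
    \<comment> \<open>Thus \<open>g = v \<otimes> z \<otimes> inv w\<close>, a path from
      \<open>P\<close> to \<open>R\<close>, within \<open>R\<close>, and from \<open>R\<close> to
      \<open>Q\<close>.\<close>
    define z where "z = inv v \<otimes> (g \<otimes> w)"
    have z: "z \<in> normalizer_of G R"
    proof -
      have "conjg G z ` conjg G v ` P = conjg G w ` conjg G g ` P"
        using vw g PG by (simp add: z_def conjg_image_conjg) (simp flip: m_assoc)
      then show ?thesis using vP wQ vw g by (simp add: normalizer_of_def Q_def z_def)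
    qed
    \<comment> \<open>The conjugate of \<open>X\<close> by \<open>y\<close> is a Sylow subgroup of
      \<open>normalizer_of G R\<close> and lies in \<open>S\<close>, so the intersection is at least
      as large.\<close>
    have "sylow_subgroup p (G\<lparr>carrier := normalizer_of G R\<rparr>) (S \<inter> normalizer_of G R)"
    proof -
      have NR: "normalizer_of G R = conjg G y ` ?N" using normalizer_of_conjg[OF PG y(1)] by (simp add: R_def)
      have sNR: "subgroup (normalizer_of G R) G" by (rule subgroup_normalizer_of[OF RG])
      interpret R: fin_group "G\<lparr>carrier := normalizer_of G R\<rparr>" using sNR fin_group_subgroup by blast
      have c: "card (normalizer_of G R) = card ?N" unfolding NR by (rule card_conjg[OF y(1) subgroup.subset[OF N]])
      have yX: "subgroup (conjg G y ` X) G" "conjg G y ` X \<subseteq> normalizer_of G R" "card (conjg G y ` X) = card X"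
        using subgroup_conjg[OF y(1) X'(1)] X'(2) NR card_conjg[OF y(1) XG] by auto
      then have syl: "sylow_subgroup p (G\<lparr>carrier := normalizer_of G R\<rparr>) (conjg G y ` X)"
        using X'(3) c sNR by (simp add: sylow_subgroup_def subgroup_subgroup_iff order_def)
      obtain k where k: "card (S \<inter> normalizer_of G R) = p ^ k" using psub[OF sNS[OF RG]] by blast
      have "card (conjg G y ` X) \<le> card (S \<inter> normalizer_of G R)"
        using finS y(2) yX(2) by (intro card_mono) auto
      from R.sylow_card_ge[OF p syl _ k this] show ?thesis
        using sNS[OF RG] sNR by (simp add: subgroup_subgroup_iff)
    qed
    from controls_normalizer[OF p S' R(1) RS this alt[OF R(1) RS this] _ z] IH
    have "controls G S R z" by (simp add: R(2))
    then obtain d where d: "d \<in> normalizer_of G S" "\<And>x. x \<in> R \<Longrightarrow> conjg G z x = conjg G d x"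
      by (auto simp: controls_def)
    have abd: "a \<in> carrier G" "b \<in> carrier G" "d \<in> carrier G" using a b d normalizer_ofD by blast+
    have nS: "subgroup (normalizer_of G S) G" by (rule subgroup_normalizer_of[OF SG])
    have "conjg G g x = conjg G (a \<otimes> d \<otimes> inv b) x" if x: "x \<in> P" for x
    proof -
      have xG: "x \<in> carrier G" using x PG by blast
      have "conjg G g x \<in> Q" using x by (simp add: Q_def)
      then have "conjg G b (conjg G g x) = conjg G w (conjg G g x)" using b by simp
      also have "\<dots> = conjg G z (conjg G v x)"
        using vw g xG by (simp add: z_def conjg_conjg) (simp flip: m_assoc)
      also have "\<dots> = conjg G d (conjg G a x)" using d(2)[of "conjg G v x"] vP x a(2) by force
      finally have "conjg G (inv b) (conjg G b (conjg G g x)) = conjg G (inv b) (conjg G d (conjg G a x))" by simp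
      then show ?thesis using abd g xG by (simp add: conjg_conjg m_assoc)
    qed
    moreover have "a \<otimes> d \<otimes> inv b \<in> normalizer_of G S"
      using a b d by (intro subgroup.m_closed[OF nS] subgroup.m_inv_closed[OF nS])
    ultimately show ?thesis by (auto simp: controls_def)
  qed
qed

subsection \<open>Supersolvability of the fusion system\<close>

lemma (in group) comm_group_subgroup_mono:
  assumes "subgroup H G" "subgroup K G" "H \<subseteq> K" "comm_group (G\<lparr>carrier := K\<rparr>)"
  shows "comm_group (G\<lparr>carrier := H\<rparr>)"
proof -
  interpret K: comm_group "G\<lparr>carrier := K\<rparr>" by (rule assms(4))
  interpret H: group "G\<lparr>carrier := H\<rparr>" using assms(1) is_group subgroup.subgroup_is_group by blast
  show ?thesis by (rule H.group_comm_groupI) (use K.m_comm assms(3) in auto)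
qed

lemma (in fin_group) card_rcosets_subgroup:
  assumes "subgroup H G" "subgroup K G" "H \<subseteq> K"
  shows "card (rcosets\<^bsub>G\<lparr>carrier := K\<rparr>\<^esub> H) * card H = card K"
proof -
  interpret K: fin_group "G\<lparr>carrier := K\<rparr>" using assms(2) fin_group_subgroup by blast
  show ?thesis using K.lagrange[of H] assms by (simp add: subgroup_subgroup_iff order_def)
qed

text \<open>The hypotheses on \<open>D\<close> are passed on from \<open>S\<close> in
  \<open>G\<close> to the \<open>p\<close>-core of \<open>N\<close>: the restriction condition of
  \<open>eternal8\<close> takes \<open>rel\<close> from \<open>G\<close> to \<open>N\<close>, and
  \<open>D\<close>, which may lie outside the \<open>p\<close>-core, is replaced by a subgroup
  \<open>D0\<close> of the same order inside it.\<close>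

lemma eternal8_p_core_le_hypercenter:
  fixes G :: "'a monoid" and rel :: "'a set \<Rightarrow> 'a monoid \<Rightarrow> bool" and p :: nat
  assumes rel: "eternal8 rel" and G: "fin_group G" and p: "Factorial_Ring.prime p"
    and S: "subgroup S G" "card S = p ^ s" and D: "subgroup D G" "D \<subseteq> S" "1 < card D"
    and relD: "\<And>H. \<lbrakk>subgroup H G; H \<subseteq> S; card H = card D\<rbrakk> \<Longrightarrow> rel H G"
    and rel2: "\<not> comm_group (G\<lparr>carrier := S\<rparr>) \<and> p = 2 \<and> card (rcosets\<^bsub>G\<lparr>carrier := S\<rparr>\<^esub> D) > 2 \<Longrightarrow>
      \<forall>H. subgroup H G \<and> H \<subseteq> S \<and> card H = 2 * card D \<longrightarrow> rel H G"
    and N: "subgroup N G" and le: "p_core p (G\<lparr>carrier := N\<rparr>) \<subseteq> S"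
    and lt: "card D < card (p_core p (G\<lparr>carrier := N\<rparr>))"
  shows "p_core p (G\<lparr>carrier := N\<rparr>) \<subseteq> supersolvable_hypercenter (G\<lparr>carrier := N\<rparr>)"
proof -
  interpret fin_group G by (rule G)
  let ?M = "G\<lparr>carrier := N\<rparr>" and ?O = "p_core p (G\<lparr>carrier := N\<rparr>)"
  interpret M: fin_group ?M using N fin_group_subgroup by blast
  have OM: "subgroup ?O ?M" using M.p_core_normal[OF p] normal_imp_subgroup by blast
  then have O: "subgroup ?O G" "?O \<subseteq> N" using N by (auto simp: subgroup_subgroup_iff)
  obtain k where k: "card ?O = p ^ k" using M.p_core_is_p_subgroup[OF p] by (auto simp: is_p_subgroup_def)
  obtain d where d: "card D = p ^ d" using card_subgroup_dvd[OF D(1) S(1) D(2)] S(2) dvd_prime_power_nat[OF p] by metis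
  have p1: "1 < p" using prime_gt_1_nat[OF p] .
  have dk: "d < k" using lt k d p1 by simp
  have relM: "rel H ?M" if "subgroup H G" "H \<subseteq> N" "rel H G" for H
    using rel N that is_group fin unfolding eternal8_def by blast
  interpret O: fin_group "G\<lparr>carrier := ?O\<rparr>" using O fin_group_subgroup by blast
  \<comment> \<open>The trivial subgroup, of order \<open>p ^ 0\<close>, is enlarged to order
    \<open>card D\<close> inside the \<open>p\<close>-core.\<close>
  obtain D0 where D0: "subgroup D0 (G\<lparr>carrier := ?O\<rparr>)" "card D0 = p ^ d"
    using O.p_group_overgroup[OF p _ O.one_is_normal[THEN normal_imp_subgroup], of k 0 d] k dk
    by (auto simp: order_def)
  then have D0': "subgroup D0 G" "D0 \<subseteq> ?O" "card D0 = card D" using O(1) d by (auto simp: subgroup_subgroup_iff)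
  have "p dvd card ?O" using k dk by simp
  then have pM: "p dvd order ?M" using M.lagrange[OF OM] by (metis dvd_mult)
  have "rel H ?M" if "subgroup H ?M" "H \<subseteq> ?O" "card H = card D0" for H
    using that relM relD le D0'(3) N O(2) by (auto simp: subgroup_subgroup_iff)
  moreover have "rel H ?M" if nc: "\<not> comm_group (?M\<lparr>carrier := ?O\<rparr>)" and "is_p_subgroup 2 ?M ?O"
    and idx: "card (rcosets\<^bsub>?M\<lparr>carrier := ?O\<rparr>\<^esub> D0) > 2"
    and H: "subgroup H ?M" "H \<subseteq> ?O" "card H = 2 * card D0" for H
  proof -
    \<comment> \<open>The \<open>p\<close>-core is nontrivial, so being a 2-group as well forces
      \<open>p = 2\<close>.\<close>
    obtain l where l: "card ?O = 2 ^ l" using \<open>is_p_subgroup 2 ?M ?O\<close> by (auto simp: is_p_subgroup_def)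
    have "p dvd 2 ^ l" using \<open>p dvd card ?O\<close> l by simp
    then have "p dvd 2" using prime_dvd_power p by blast
    then have p2: "p = 2" using p two_is_prime_nat primes_dvd_imp_eq by blast
    have "\<not> comm_group (G\<lparr>carrier := S\<rparr>)" using nc comm_group_subgroup_mono[OF O(1) S(1) le] by auto
    moreover have "card (rcosets\<^bsub>G\<lparr>carrier := S\<rparr>\<^esub> D) > 2"
    proof -
      \<comment> \<open>\<open>D0\<close> and \<open>D\<close> have the same order and the
        \<open>p\<close>-core lies in \<open>S\<close>, so the index of \<open>D\<close> in
        \<open>S\<close> is at least that of \<open>D0\<close> in the \<open>p\<close>-core.\<close>
      have "card (rcosets\<^bsub>G\<lparr>carrier := ?O\<rparr>\<^esub> D0) * card D \<le> card (rcosets\<^bsub>G\<lparr>carrier := S\<rparr>\<^esub> D) * card D"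
        using card_rcosets_subgroup[OF D0'(1) O(1) D0'(2)] card_rcosets_subgroup[OF D(1) S(1) D(2)] D0'(3)
          card_mono[OF finite_subgroup[OF S(1)] le] by simp
      then show ?thesis using idx D(3) by simp
    qed
    ultimately have "rel H G" using rel2 p2 H D0'(3) le N by (auto simp: subgroup_subgroup_iff)
    then show ?thesis using relM H O(2) N by (auto simp: subgroup_subgroup_iff)
  qed
  moreover have "subgroup D0 ?M" using D0' O(2) N by (auto simp: subgroup_subgroup_iff)
  ultimately have "\<exists>D. subgroup D ?M \<and> D \<subseteq> ?O \<and> 1 < card D \<and> card D < card ?O \<and>
      (\<forall>H. subgroup H ?M \<and> H \<subseteq> ?O \<and> card H = card D \<longrightarrow> rel H ?M) \<and>
      (\<not> comm_group (?M\<lparr>carrier := ?O\<rparr>) \<and> is_p_subgroup 2 ?M ?O \<and>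
        card (rcosets\<^bsub>?M\<lparr>carrier := ?O\<rparr>\<^esub> D) > 2 \<longrightarrow>
        (\<forall>H. subgroup H ?M \<and> H \<subseteq> ?O \<and> cyclic_group (?M\<lparr>carrier := H\<rparr>) \<and> card H = 2 * card D \<longrightarrow> rel H ?M))"
    using D0' D(3) lt by (intro exI[of _ D0]) auto
  then show ?thesis using rel M.is_group M.fin p pM unfolding eternal8_def by blast
qed

section \<open>Chief series and strongly closed subgroups\<close>

lemma (in fin_group) chief_series:
  assumes "L \<lhd> G"
  shows "\<exists>n T. T 0 = {\<one>} \<and> T n = L \<and> (\<forall>i\<le>n. T i \<lhd> G) \<and> (\<forall>i<n. chief_factor G (T (Suc i)) (T i))"
  using assms
proof (induction "card L" arbitrary: L rule: less_induct)
  case less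
  show ?case
  proof (cases "L = {\<one>}")
    case True
    then show ?thesis using less.prems by (intro exI[of _ 0] exI[of _ "\<lambda>_. L"]) auto
  next
    case False
    then obtain A where A: "chief_factor G L A" using chief_factor_below less.prems by blast
    note c = chief_factorD[OF A]
    have "card A < card L" using c(3) finite_subset[OF normal_subset[OF c(1)]] by (simp add: psubset_card_mono)
    from less.hyps[OF this c(2)] obtain n T where
      T: "T 0 = {\<one>}" "T n = A" "\<forall>i\<le>n. T i \<lhd> G" "\<forall>i<n. chief_factor G (T (Suc i)) (T i)" by blast
    show ?thesis
      using T A c(1) by (intro exI[of _ "Suc n"] exI[of _ "T(Suc n := L)"]) (auto simp: le_Suc_eq less_Suc_eq)
  qed
qed

lemma hypercentral_mono: "hypercentral G M \<Longrightarrow> N \<subseteq> M \<Longrightarrow> hypercentral G N"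
  unfolding hypercentral_def by blast

text \<open>A chief series of the normalizer of \<open>S\<close> up to \<open>S\<close> is the
  required series: its terms are invariant under that normalizer, which by \<open>ctrl\<close>
  induces all morphisms, so they are strongly closed; the factors are cyclic by
  \<open>hyp\<close>.\<close>

lemma (in fin_group) supersolvable_fusion_if_controlled:
  assumes S: "subgroup S G"
    and hyp: "hypercentral (G\<lparr>carrier := normalizer_of G S\<rparr>) S"
    and ctrl: "\<And>P g. \<lbrakk>subgroup P G; P \<subseteq> S; g \<in> carrier G; conjg G g ` P \<subseteq> S\<rbrakk> \<Longrightarrow> controls G S P g"
  shows "supersolvable_fusion (G\<lparr>carrier := S\<rparr>) (group_fusion G S)"
proof -
  let ?N = "normalizer_of G S" and ?M = "G\<lparr>carrier := normalizer_of G S\<rparr>"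
  have SG: "S \<subseteq> carrier G" using S subgroup.subset by blast
  have N: "subgroup ?N G" by (rule subgroup_normalizer_of[OF SG])
  interpret M: fin_group ?M using N fin_group_subgroup by blast
  have SN: "S \<subseteq> ?N" by (rule subgroup_subset_normalizer_of[OF S])
  have SM: "subgroup S ?M" using S SN N by (simp add: subgroup_subgroup_iff)
  obtain n T where T: "T 0 = {\<one>}" "T n = S" "\<And>i. i \<le> n \<Longrightarrow> T i \<lhd> ?M"
    "\<And>i. i < n \<Longrightarrow> chief_factor ?M (T (Suc i)) (T i)"
    using M.chief_series[OF normal_normalizer_of[OF S]] by (auto)
  \<comment> \<open>Descending induction from \<open>T n = S\<close>. Truncated subtraction makes
    the claim for \<open>j \<ge> n\<close> one about \<open>T 0\<close>.\<close>
  have "T (n - j) \<subseteq> S" for j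
  proof (induction j)
    case (Suc j)
    show ?case
    proof (cases "j < n")
      case True
      then have "T (n - Suc j) \<subset> T (Suc (n - Suc j))" using T(4)[of "n - Suc j"] chief_factorD(3) by fastforce
      then show ?thesis using Suc True by (simp add: Suc_diff_Suc)
    qed (use Suc in simp)
  qed (use T in simp)
  then have TS: "T i \<subseteq> S" if "i \<le> n" for i using that by (metis diff_diff_cancel)
  have sT: "subgroup (T i) G" if "i \<le> n" for i
    using normal_imp_subgroup[OF T(3)[OF that]] N by (auto simp: subgroup_subgroup_iff)
  have closed: "strongly_closed (G\<lparr>carrier := S\<rparr>) (group_fusion G S) (T i)" if i: "i \<le> n" for i
    unfolding strongly_closed_def
  proof (intro conjI allI impI)
    show "subgroup (T i) (G\<lparr>carrier := S\<rparr>)" using sT TS S i by (simp add: subgroup_subgroup_iff)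
    fix P \<phi> assume "subgroup P (G\<lparr>carrier := S\<rparr>) \<and> P \<subseteq> T i \<and> \<phi> \<in> group_fusion G S P (carrier (G\<lparr>carrier := S\<rparr>))"
    then have P: "subgroup P G" "P \<subseteq> S" "P \<subseteq> T i" and "\<phi> \<in> group_fusion G S P S"
      using S by (auto simp: subgroup_subgroup_iff)
    then obtain g where g: "g \<in> carrier G" "\<phi> = restrict (conjg G g) P" "conjg G g ` P \<subseteq> S"
      unfolding group_fusion_def conjg_def by blast
    obtain m where m: "m \<in> ?N" "\<And>x. x \<in> P \<Longrightarrow> conjg G g x = conjg G m x"
      using ctrl[OF P(1,2) g(1,3)] by (auto simp: controls_def)
    show "\<phi> ` P \<subseteq> T i"
    proof
      fix y assume "y \<in> \<phi> ` P"
      then obtain x where x: "x \<in> P" "y = conjg G m x" using g m by auto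
      then have "conjg ?M m x \<in> T i" using T(3)[OF i] P m(1) M.normal_conjg_iff by auto
      then show "y \<in> T i" using x m(1) by (simp add: conjg_consistent[OF N])
    qed
  qed
  have step: "T i \<subseteq> T (Suc i) \<and> T i \<lhd> G\<lparr>carrier := S\<rparr>\<lparr>carrier := T (Suc i)\<rparr> \<and>
      cyclic_group (G\<lparr>carrier := S\<rparr>\<lparr>carrier := T (Suc i)\<rparr> Mod T i)" if i: "i < n" for i
  proof -
    note ch = T(4)[OF i]
    have "T i \<subseteq> T (Suc i)" using chief_factorD(3)[OF ch] by blast
    moreover have "T i \<lhd> ?M\<lparr>carrier := T (Suc i)\<rparr>"
      using M.normal_restrict_supergroup normal_imp_subgroup chief_factorD(1-3)[OF ch] by blast
    moreover have "cyclic_mod ?M (T (Suc i)) (T i)" using hyp ch TS[of "Suc i"] i by (auto simp: hypercentral_def)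
    then have "cyclic_group (?M\<lparr>carrier := T (Suc i)\<rparr> Mod T i)" using M.cyclic_group_chief_factor_iff[OF ch] by simp
    ultimately show ?thesis by simp
  qed
  show ?thesis
    unfolding supersolvable_fusion_def
    by (rule exI[of _ n], rule exI[of _ T]) (use T(1,2) closed step in auto)
qed

theorem theorem3p15:
  fixes rel :: "'a set \<Rightarrow> 'a monoid \<Rightarrow> bool"
    and G :: "'a monoid" and p :: nat and S D :: "'a set"
  assumes "eternal8 rel"
    and "group G" and "finite (carrier G)"
    and "Factorial_Ring.prime p" and "p dvd order G"
    and "sylow_subgroup p G S"
    and "subgroup D G" and "D \<subseteq> S" and "1 < card D" and "card D < card S"
    and "\<And>H. subgroup H G \<Longrightarrow> H \<subseteq> S \<Longrightarrow> card H = card D \<or> card H = p * card D \<Longrightarrow>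
           comm_group (G\<lparr>carrier := H\<rparr>)"
    and "\<And>H. subgroup H G \<Longrightarrow> H \<subseteq> S \<Longrightarrow> card H = card D \<Longrightarrow> rel H G"
    and "\<not> comm_group (G\<lparr>carrier := S\<rparr>) \<and> p = 2 \<and> card (rcosets\<^bsub>G\<lparr>carrier := S\<rparr>\<^esub> D) > 2 \<Longrightarrow>
           (\<forall>H. subgroup H G \<and> H \<subseteq> S \<and> card H = 2 * card D \<longrightarrow> rel H G)"
  shows "supersolvable_fusion (G\<lparr>carrier := S\<rparr>) (group_fusion G S)"
proof -
  interpret fin_group G using assms(2,3) by (rule fin_groupI)
  note p = assms(4) and D = assms(7-9)
  let ?s = "multiplicity p (order G)"
  have S: "subgroup S G" "card S = p ^ ?s" using assms(6) by (auto simp: sylow_subgroup_def)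
  have SG: "S \<subseteq> carrier G" using S subgroup.subset by blast
  have p1: "1 < p" using prime_gt_1_nat[OF p] .
  obtain d where d: "card D = p ^ d"
    using card_subgroup_dvd[OF D(1) S(1) D(2)] S(2) dvd_prime_power_nat[OF p] by metis
  have ds: "d < ?s" using assms(10) d S(2) p1 by simp
  interpret S: fin_group "G\<lparr>carrier := S\<rparr>" using S fin_group_subgroup by blast
  \<comment> \<open>\<open>R\<close> lies in the \<open>p\<close>-core of its normalizer, and the
    \<open>p\<close>-core lies in every Sylow subgroup there, hence in \<open>S\<close>. The case
    \<open>R = S\<close> is included for use at the end.\<close>
  have big: "hypercentral (G\<lparr>carrier := normalizer_of G R\<rparr>) R"
    if R: "subgroup R G" "card D < card R" "R \<subseteq> S"
      and T: "sylow_subgroup p (G\<lparr>carrier := normalizer_of G R\<rparr>) (S \<inter> normalizer_of G R)" for R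
  proof -
    let ?M = "G\<lparr>carrier := normalizer_of G R\<rparr>"
    have N: "subgroup (normalizer_of G R) G" using subgroup_normalizer_of R(3) SG by blast
    interpret M: fin_group ?M using N fin_group_subgroup by blast
    have RM: "R \<lhd> ?M" by (rule normal_normalizer_of[OF R(1)])
    obtain r where "card R = p ^ r"
      using card_subgroup_dvd[OF R(1) S(1) R(3)] S(2) dvd_prime_power_nat[OF p] by metis
    then have RO: "R \<subseteq> p_core p ?M"
      using M.p_core_greatest[OF p RM] normal_imp_subgroup[OF RM] by (auto simp: is_p_subgroup_def)
    obtain k where "card (p_core p ?M) = p ^ k"
      using M.p_core_is_p_subgroup[OF p] by (auto simp: is_p_subgroup_def)
    from M.normal_p_subgroup_le_sylow[OF p T M.p_core_normal[OF p] this]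
    have OS: "p_core p ?M \<subseteq> S" by blast
    have "card D < card (p_core p ?M)"
      using R(2) card_mono[OF finite_subset[OF OS finite_subgroup[OF S(1)]] RO] by simp
    then have "p_core p ?M \<subseteq> supersolvable_hypercenter ?M"
      by (intro eternal8_p_core_le_hypercenter[OF assms(1) fin_group_axioms p S D assms(12,13) N OS])
    then show ?thesis using hypercentral_mono[OF M.hypercentral_supersolvable_hypercenter] RO by blast
  qed
  have alt: "(\<exists>H. subgroup H G \<and> R \<subset> H \<and> H \<subseteq> S \<and> comm_group (G\<lparr>carrier := H\<rparr>)) \<or>
      hypercentral (G\<lparr>carrier := normalizer_of G R\<rparr>) R"
    if R: "subgroup R G" "R \<subset> S"
      and T: "sylow_subgroup p (G\<lparr>carrier := normalizer_of G R\<rparr>) (S \<inter> normalizer_of G R)" for R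
  proof (cases "card R \<le> card D")
    case True
    obtain r where r: "card R = p ^ r"
      using card_subgroup_dvd[OF R(1) S(1)] R(2) S(2) dvd_prime_power_nat[OF p] by (metis psubset_imp_subset)
    have "r \<le> d" using True r d p1 by simp
    moreover have "subgroup R (G\<lparr>carrier := S\<rparr>)" using R S(1) by (simp add: subgroup_subgroup_iff psubset_imp_subset)
    moreover have "order (G\<lparr>carrier := S\<rparr>) = p ^ ?s" using S(2) by (simp add: order_def)
    \<comment> \<open>The order \<open>p ^ Suc d = p * card D\<close> makes \<open>H\<close> abelian
      by hypothesis, and larger than \<open>R\<close> even if
      \<open>card R = card D\<close>.\<close>
    ultimately obtain H where "subgroup H (G\<lparr>carrier := S\<rparr>)" and RH: "R \<subseteq> H" and cH: "card H = p ^ Suc d"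
      using S.p_group_overgroup[OF p _ _ r, of ?s "Suc d"] ds by (metis Suc_leI le_SucI)
    then have H: "subgroup H G" "H \<subseteq> S" using S(1) by (auto simp: subgroup_subgroup_iff)
    then have "comm_group (G\<lparr>carrier := H\<rparr>)" using assms(11) cH d by simp
    moreover have "card R < card H" using \<open>r \<le> d\<close> p1 by (simp add: r cH power_strict_increasing flip: power_Suc)
    then have "R \<noteq> H" by blast
    ultimately show ?thesis using H RH by blast
  next
    case False
    then show ?thesis using big[OF R(1) _ _ T] R(2) by auto
  qed
  \<comment> \<open>As \<open>S\<close> is contained in its normalizer, the intersection is
    \<open>S\<close>, so \<open>big\<close> applies with \<open>R = S\<close>.\<close>
  have "sylow_subgroup p (G\<lparr>carrier := normalizer_of G S\<rparr>) (S \<inter> normalizer_of G S)"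
    using sylow_subgroup_of_subgroup[OF p assms(6) subgroup_normalizer_of[OF SG] subgroup_subset_normalizer_of[OF S(1)]]
      subgroup_subset_normalizer_of[OF S(1)] by (simp add: Int_absorb2)
  then have "hypercentral (G\<lparr>carrier := normalizer_of G S\<rparr>) S" using big[OF S(1) assms(10)] by blast
  then show ?thesis
    using normalizer_controls_fusion[OF p assms(6) alt]
    by (intro supersolvable_fusion_if_controlled[OF S(1)])
qed

end
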